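(* Let $X$ and $Y$ be complex infinite-dimensional Banach spaces, $A\in B(X)$, $B\in B(Y)$, $C\in B(Y,X)$, and let $M_C=\begin{pmatrix}A&C\\0&B\end{pmatrix}\in B(X\oplus Y)$. If $\sigma_*$ is any one of $\sigma_{des},\sigma_r,\sigma_{rb},\sigma_{sb},\sigma_{re},\sigma_{SF-}$, then $$\sigma_*(M_C)\cup S(B)=\sigma_*(A)\cup\sigma_*(B)\cup S(B).$$
   Context: $B(Y,X)$ is the set of bounded linear operators from $Y$ to $X$, and $B(X)=B(X,X)$. For $T\in B(X)$ let $\alpha(T)=\dim N(T)$ and $\beta(T)=\dim X/R(T)$, where $N(T)$ and $R(T)$ are the kernel and range. The descent $des(T)$ is the smallest nonnegative integer $k$ with $R(T^k)=R(T^{k+1})$ ($\infty$ if none exists). Operator classes: $\Phi_-(X)=\{T:\beta(T)<\infty\}$; $\Phi_r(X)=\{T: N(T)\text{ is a closed and complemented subspace of }X\text{ and }\beta(T)<\infty\}$; $\Phi_{sb}(X)=\{T\in\Phi_-(X): des(T)<\infty\}$; $\Phi_{rb}(X)=\{T\in\Phi_r(X): des(T)<\infty\}$. Spectra: $\sigma_{des}(T)=\{\lambda\in\mathbb{C}: des(T-\lambda I)=\infty\}$; $\sigma_r(T)=\{\lambda\in\mathbb{C}:T-\lambda I\text{ is not right invertible in }B(X)\}$; $\sigma_{rb}(T)=\{\lambda\in\mathbb{C}:T-\lambda I\notin\Phi_{rb}(X)\}$; $\sigma_{sb}(T)=\{\lambda\in\mathbb{C}:T-\lambda I\notin\Phi_{sb}(X)\}$;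 $\sigma_{re}(T)=\{\lambda\in\mathbb{C}:T-\lambda I\notin\Phi_r(X)\}$; $\sigma_{SF-}(T)=\{\lambda\in\mathbb{C}:T-\lambda I\notin\Phi_-(X)\}$. The same definitions apply on $Y$ and $X\oplus Y$. $T$ has the single valued extension property (SVEP) at $\lambda\in\mathbb{C}$ if there is $r>0$ such that for every open subset $V$ of the open disc $D(\lambda,r)$, the function $f\equiv 0$ is the only analytic solution of $(T-\mu)f(\mu)=0$ for all $\mu\in V$. $S(T)=\{\lambda\in\mathbb{C}: T\text{ fails to have the SVEP at }\lambda\}$. *)

theory Defs
  imports "HOL-Analysis.Analysis" "HOL-Library.Extended_Nat"
begin

class complex_normed_vector = real_normed_vector +
  fixes scaleC :: "complex \<Rightarrow> 'a \<Rightarrow> 'a" (infixr "*\<^sub>C" 75)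
  assumes scaleC_add_right: "a *\<^sub>C (x + y) = a *\<^sub>C x + a *\<^sub>C y"
    and scaleC_add_left: "(a + b) *\<^sub>C x = a *\<^sub>C x + b *\<^sub>C x"
    and scaleC_scaleC: "a *\<^sub>C b *\<^sub>C x = (a * b) *\<^sub>C x"
    and scaleR_scaleC: "r *\<^sub>R x = complex_of_real r *\<^sub>C x"
    and norm_scaleC: "norm (a *\<^sub>C x) = cmod a * norm x"

class complex_banach = complex_normed_vector + banach

global_interpretation complex_vector:
  vector_space "scaleC :: complex \<Rightarrow> 'a \<Rightarrow> 'a::complex_normed_vector"
  defines cspan = complex_vector.span
    and csubspace = complex_vector.subspace
proof
  fix x :: 'a
  show "1 *\<^sub>C x = x"
    using scaleR_scaleC[of 1 x] by simp
qed (simp_all add: scaleC_add_right scaleC_add_left scaleC_scaleC)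

text \<open>The direct sum \<open>X \<oplus> Y\<close> is the product type. The library gives it the
  norm \<open>sqrt (\<parallel>x\<parallel>\<^sup>2 + \<parallel>y\<parallel>\<^sup>2)\<close>.\<close>

instantiation prod :: (complex_normed_vector, complex_normed_vector) complex_normed_vector
begin

definition scaleC_prod :: "complex \<Rightarrow> 'a \<times> 'b \<Rightarrow> 'a \<times> 'b" where
  "scaleC_prod c p = (c *\<^sub>C fst p, c *\<^sub>C snd p)"

instance
proof
  fix a :: complex and x :: "'a \<times> 'b"
  show "norm (a *\<^sub>C x) = cmod a * norm x"
    by (simp add: scaleC_prod_def norm_prod_def norm_scaleC power_mult_distrib
        real_sqrt_mult flip: distrib_left)
qed (simp_all add: scaleC_prod_def prod_eq_iff scaleC_add_right scaleC_add_left
    scaleC_scaleC scaleR_scaleC)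

end

instance prod :: (complex_banach, complex_banach) complex_banach ..

text \<open>\<open>bounded_clinear T\<close> is \<open>T \<in> B(X,Y)\<close>; operators are represented by their
  underlying functions.\<close>

definition bounded_clinear ::
    "('a::complex_normed_vector \<Rightarrow> 'b::complex_normed_vector) \<Rightarrow> bool" where
  "bounded_clinear T \<longleftrightarrow> bounded_linear T \<and> (\<forall>c x. T (c *\<^sub>C x) = c *\<^sub>C T x)"

definition infinite_dimensional :: "'a::complex_normed_vector itself \<Rightarrow> bool" where
  "infinite_dimensional (t :: 'a itself) \<longleftrightarrow> (\<nexists>S::'a set. finite S \<and> cspan S = UNIV)"

definition kernel :: "('a::complex_normed_vector \<Rightarrow> 'b::complex_normed_vector) \<Rightarrow> 'a set" where
  "kernel T = {x. T x = 0}"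

definition coset :: "'a::complex_normed_vector set \<Rightarrow> 'a \<Rightarrow> 'a set" where
  "coset W x = {x + w |w. w \<in> W}"

text \<open>\<open>quotient_dim W\<close> is \<open>dim X/W\<close>, for a subspace \<open>W\<close> that need not be closed: the least
  size of a finite set \<open>S\<close> whose cosets span \<open>X/W\<close>, and \<open>\<infinity>\<close> if there is none. The span of
  the cosets of \<open>S\<close> in \<open>X/W\<close> is written as the image of the span of \<open>S\<close> in \<open>X\<close>.\<close>

definition quotient_dim :: "'a::complex_normed_vector set \<Rightarrow> enat" where
  "quotient_dim W = Inf {enat (card S) |S. finite S \<and> coset W ` cspan S = range (coset W)}"

definition defect :: "('a::complex_normed_vector \<Rightarrow> 'a) \<Rightarrow> enat" where
  "defect T = quotient_dim (range T)"

text \<open>In \<^typ>\<open>enat\<close> the infimum of the empty set is \<open>\<infinity>\<close>.\<close>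

definition descent :: "('a::complex_normed_vector \<Rightarrow> 'a) \<Rightarrow> enat" where
  "descent T = Inf {enat k |k. range (T ^^ k) = range (T ^^ (k + 1))}"

definition complemented :: "'a::complex_normed_vector set \<Rightarrow> bool" where
  "complemented N \<longleftrightarrow>
    (\<exists>M. csubspace M \<and> closed M \<and> N \<inter> M = {0} \<and> {u + v |u v. u \<in> N \<and> v \<in> M} = UNIV)"

definition right_invertible :: "('a::complex_normed_vector \<Rightarrow> 'a) \<Rightarrow> bool" where
  "right_invertible T \<longleftrightarrow> (\<exists>S. bounded_clinear S \<and> T \<circ> S = id)"

definition Phi_minus :: "('a::complex_normed_vector \<Rightarrow> 'a) set" where
  "Phi_minus = {T. bounded_clinear T \<and> defect T < \<infinity>}"

definition Phi_r :: "('a::complex_normed_vector \<Rightarrow> 'a) set" where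
  "Phi_r = {T. bounded_clinear T \<and> closed (kernel T) \<and> complemented (kernel T) \<and> defect T < \<infinity>}"

definition Phi_sb :: "('a::complex_normed_vector \<Rightarrow> 'a) set" where
  "Phi_sb = {T \<in> Phi_minus. descent T < \<infinity>}"

definition Phi_rb :: "('a::complex_normed_vector \<Rightarrow> 'a) set" where
  "Phi_rb = {T \<in> Phi_r. descent T < \<infinity>}"

definition shift :: "('a::complex_normed_vector \<Rightarrow> 'a) \<Rightarrow> complex \<Rightarrow> 'a \<Rightarrow> 'a" where
  "shift T z = (\<lambda>x. T x - z *\<^sub>C x)"

definition sigma_des :: "('a::complex_normed_vector \<Rightarrow> 'a) \<Rightarrow> complex set" where
  "sigma_des T = {z. descent (shift T z) = \<infinity>}"

definition sigma_r :: "('a::complex_normed_vector \<Rightarrow> 'a) \<Rightarrow> complex set" where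
  "sigma_r T = {z. \<not> right_invertible (shift T z)}"

definition sigma_rb :: "('a::complex_normed_vector \<Rightarrow> 'a) \<Rightarrow> complex set" where
  "sigma_rb T = {z. shift T z \<notin> Phi_rb}"

definition sigma_sb :: "('a::complex_normed_vector \<Rightarrow> 'a) \<Rightarrow> complex set" where
  "sigma_sb T = {z. shift T z \<notin> Phi_sb}"

definition sigma_re :: "('a::complex_normed_vector \<Rightarrow> 'a) \<Rightarrow> complex set" where
  "sigma_re T = {z. shift T z \<notin> Phi_r}"

definition sigma_SF_minus :: "('a::complex_normed_vector \<Rightarrow> 'a) \<Rightarrow> complex set" where
  "sigma_SF_minus T = {z. shift T z \<notin> Phi_minus}"

text \<open>Analyticity of a vector-valued function on an open set \<open>V\<close>: complex differentiability in
  norm at every point (the library's \<open>holomorphic_on\<close> and \<open>analytic_on\<close> only cover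
  \<^typ>\<open>complex \<Rightarrow> complex\<close>).\<close>

definition vanalytic_on :: "(complex \<Rightarrow> 'a::complex_normed_vector) \<Rightarrow> complex set \<Rightarrow> bool" where
  "vanalytic_on f V \<longleftrightarrow> (\<forall>z\<in>V. \<exists>d. (f has_derivative (\<lambda>h. h *\<^sub>C d)) (at z))"

definition SVEP_at :: "('a::complex_normed_vector \<Rightarrow> 'a) \<Rightarrow> complex \<Rightarrow> bool" where
  "SVEP_at T z \<longleftrightarrow>
    (\<exists>r>0. \<forall>V. open V \<and> V \<subseteq> ball z r \<longrightarrow>
      (\<forall>f. vanalytic_on f V \<and> (\<forall>\<mu>\<in>V. shift T \<mu> (f \<mu>) = 0) \<longrightarrow> (\<forall>\<mu>\<in>V. f \<mu> = 0)))"

definition S_set :: "('a::complex_normed_vector \<Rightarrow> 'a) \<Rightarrow> complex set" where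
  "S_set T = {z. \<not> SVEP_at T z}"

definition upper_tri ::
    "('a::complex_normed_vector \<Rightarrow> 'a) \<Rightarrow> ('b::complex_normed_vector \<Rightarrow> 'a) \<Rightarrow> ('b \<Rightarrow> 'b)
      \<Rightarrow> 'a \<times> 'b \<Rightarrow> 'a \<times> 'b" where
  "upper_tri A C B = (\<lambda>(x, y). (A x + C y, B y))"

end

theory Submission
  imports Defs
begin

text \<open>
  Shifting by \<open>z\<close> turns \<open>M\<close> into the triangular matrix of \<open>A - z\<close>, \<open>C\<close>, \<open>B - z\<close>. So it is enough to
  show, at each \<open>z\<close> where \<open>B\<close> has the single valued extension property (SVEP), that the matrix
  belongs to one of the operator classes exactly when both diagonal entries do. That the property
  passes from \<open>A\<close> and \<open>B\<close> to \<open>M\<close>, and from \<open>M\<close> to the quotient operator \<open>B\<close>, holds for every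
  triangular matrix. Passing from \<open>M\<close> to \<open>A\<close> can fail, because vectors \<open>(u, v)\<close> that \<open>M\<close> sends into
  \<open>X \<times> {0}\<close> have \<open>v\<close> in the kernel of \<open>B\<close>; the SVEP controls that kernel.

  The link between the SVEP and the kernel is a local form of Finch's theorem. Write \<open>T = B - z\<close>. If
  \<open>T y\<^sub>0 = 0\<close> and \<open>T y\<^sub>n\<^sub>+\<^sub>1 = y\<^sub>n\<close> with geometrically bounded norms, then
  \<open>f \<mu> = (\<Sum>n. (\<mu> - z)\<^sup>n y\<^sub>n)\<close> solves \<open>(B - \<mu>) f \<mu> = 0\<close>, so \<open>y\<^sub>0 = f z = 0\<close>
  (\<open>SVEP_backward_orbit_trivial\<close>). The geometric bound is free whenever preimages can be
  chosen inside a closed subspace, by a version of the open mapping theorem for closed linear relations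
  (\<open>closed_relation_bounded_selection\<close>). Together they give
  \<open>SVEP_kernel_Int_image_trivial\<close>, which is used in two ways.

  \<^item> If \<open>T\<close> has descent \<open>q\<close>, then \<open>N(T) \<inter> R(T\<^sup>q) = 0\<close>, so \<open>T\<close> has finite ascent; for surjective \<open>T\<close>
    this is injectivity. Finite ascent is what the transfer of descent from \<open>M\<close> to \<open>A\<close> needs.

  \<^item> If \<open>T\<close> has finite defect, then \<open>T\<close> maps the intersection of all \<open>R(T\<^sup>n)\<close>, a closed subspace, onto
    itself, and this intersection meets \<open>N(T)\<close> in the same set as some \<open>R(T\<^sup>d)\<close>. Hence
    \<open>N(T) \<inter> R(T\<^sup>d) = 0\<close>, and \<open>N(T)\<close> is finite-dimensional because \<open>R(T\<^sup>d)\<close> has finite codimension.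
    The Fredholm-type classes do not see a finite-dimensional kernel.

  The class \<open>\<Phi>\<^sub>r\<close> is handled through right inverses modulo operators of finite rank (\<open>Phi_r_iff\<close>),
  which are computed for triangular matrices by the same formula as exact right inverses.
\<close>

section \<open>Bounded complex-linear operators\<close>

lemma bounded_bilinear_scaleC:
  "bounded_bilinear (scaleC :: complex \<Rightarrow> 'a::complex_normed_vector \<Rightarrow> 'a)"
proof
  fix a a' :: complex and b b' :: 'a and r :: real
  show "(a + a') *\<^sub>C b = a *\<^sub>C b + a' *\<^sub>C b"
    by (rule scaleC_add_left)
  show "a *\<^sub>C (b + b') = a *\<^sub>C b + a *\<^sub>C b'"
    by (rule scaleC_add_right)
  show "(r *\<^sub>R a) *\<^sub>C b = r *\<^sub>R a *\<^sub>C b"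
    by (simp add: scaleR_scaleC scaleC_scaleC scaleR_conv_of_real)
  show "a *\<^sub>C (r *\<^sub>R b) = r *\<^sub>R a *\<^sub>C b"
    by (simp add: scaleR_scaleC scaleC_scaleC mult.commute)
  show "\<exists>K. \<forall>a (b::'a). norm (a *\<^sub>C b) \<le> norm a * norm b * K"
    by (rule exI[of _ 1]) (simp add: norm_scaleC)
qed

lemmas tendsto_scaleC = bounded_bilinear.tendsto[OF bounded_bilinear_scaleC]

abbreviation clinear :: "('a::complex_normed_vector \<Rightarrow> 'b::complex_normed_vector) \<Rightarrow> bool" where
  "clinear \<equiv> module_hom scaleC scaleC"

lemma clinearI:
  assumes "\<And>x y. T (x + y) = T x + T y" "\<And>c x. T (c *\<^sub>C x) = c *\<^sub>C T x"
  shows "clinear T"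
  by unfold_locales (auto simp: assms scaleC_add_right scaleC_add_left scaleC_scaleC)

lemma bounded_clinear_imp_clinear: "bounded_clinear T \<Longrightarrow> clinear T"
  by (rule clinearI) (auto simp: bounded_clinear_def linear_simps)

lemma clinear_funpow:
  fixes T :: "'a::complex_normed_vector \<Rightarrow> 'a"
  assumes "clinear T"
  shows "clinear (T ^^ n)"
proof (induction n)
  case 0
  show ?case
    by (rule clinearI) auto
next
  case (Suc n)
  show ?case
    by (rule clinearI)
      (simp_all add: module_hom.add[OF assms] module_hom.scale[OF assms]
        module_hom.add[OF Suc] module_hom.scale[OF Suc])
qed

lemma bounded_clinear_funpow:
  fixes T :: "'a::complex_normed_vector \<Rightarrow> 'a"
  assumes "bounded_clinear T"
  shows "bounded_clinear (T ^^ n)"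
proof (induction n)
  case 0
  show ?case
    by (simp add: bounded_clinear_def id_def)
next
  case (Suc n)
  with assms show ?case
    using bounded_linear_compose[of T "T ^^ n"] by (simp add: bounded_clinear_def o_def)
qed

lemma clinear_image_cspan:
  assumes "clinear T"
  shows "T ` cspan S = cspan (T ` S)"
  using module_hom.span_image[OF assms, of S] by (simp add: cspan_def)

lemma csubspace_image: "clinear T \<Longrightarrow> csubspace S \<Longrightarrow> csubspace (T ` S)"
  using module_hom.subspace_image[of scaleC scaleC T S] by (simp add: csubspace_def)

lemma csubspace_range: "clinear T \<Longrightarrow> csubspace (range T)"
  by (simp add: csubspace_image)

lemma csubspace_vimage: "clinear T \<Longrightarrow> csubspace S \<Longrightarrow> csubspace (T -` S)"
  using module_hom.subspace_vimage[of scaleC scaleC T S] by (simp add: csubspace_def)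

lemma csubspace_kernel: "clinear T \<Longrightarrow> csubspace (kernel T)"
  using module_hom.subspace_kernel[of scaleC scaleC T] by (simp add: csubspace_def kernel_def)

lemma csubspace_imp_subspace: "csubspace W \<Longrightarrow> subspace W"
  by (auto simp: subspace_def complex_vector.subspace_def scaleR_scaleC)

lemma closed_kernel: "bounded_clinear T \<Longrightarrow> closed (kernel T)"
  unfolding kernel_def bounded_clinear_def
  by (intro closed_Collect_eq continuous_intros linear_continuous_on) auto

section \<open>Bounded selections of closed linear relations\<close>

text \<open>The open mapping theorem for a closed linear relation \<open>G\<close>, proved as usual: by Baire, one of the sets
  of points with a partner of norm at most \<open>n\<close> is dense in some ball of \<open>D\<close>, and successive
  approximation removes the closure. A relation covers at once closed graphs, surjective operators and
  equations that are only solvable modulo a subspace.\<close>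

lemma closed_relation_bounded_selection:
  fixes G :: "('u::banach \<times> 'v::banach) set"
  assumes D: "closed D" "subspace D" and G: "closed G" "subspace G"
    and total: "\<And>u. u \<in> D \<Longrightarrow> \<exists>v. (u, v) \<in> G"
  shows "\<exists>K. \<forall>u\<in>D. \<exists>v. (u, v) \<in> G \<and> norm v \<le> K * norm u"
proof -
  define P where "P n = {u \<in> D. \<exists>v. (u, v) \<in> G \<and> norm v \<le> real n}" for n
  define C where "C n = closure (P n)" for n
  have C_sub: "C n \<subseteq> D" for n
    unfolding C_def P_def using D(1) by (intro closure_minimal) auto
  have "D = (\<Union>n. C n)"
  proof
    show "D \<subseteq> (\<Union>n. C n)"
    proof
      fix u assume "u \<in> D"
      with total obtain v where v: "(u, v) \<in> G" by blast
      obtain n where "norm v \<le> real n"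
        using real_arch_simple by blast
      with v \<open>u \<in> D\<close> have "u \<in> P n"
        by (auto simp: P_def)
      then show "u \<in> (\<Union>n. C n)"
        using closure_subset by (force simp: C_def)
    qed
  qed (use C_sub in auto)
  have "\<exists>n. top_of_set D interior_of C n \<noteq> {}"
  proof (rule ccontr)
    assume "\<not> ?thesis"
    then have int: "top_of_set D interior_of C n = {}" for n by blast
    have cm: "completely_metrizable_space (top_of_set D)"
      using D(1) by (intro completely_metrizable_space_closedin completely_metrizable_space_euclidean)
        auto
    have "closedin (top_of_set D) (C n)" for n
      using C_sub by (intro closed_subset) (auto simp: C_def)
    then have "top_of_set D interior_of \<Union> (range C) = {}"
      using cm int by (intro Baire_category_alt) auto
    then have "top_of_set D interior_of D = {}"
      using \<open>D = (\<Union>n. C n)\<close> by simp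
    then have "D = {}"
      by (metis interior_of_topspace topspace_euclidean_subtopology)
    then show False
      using subspace_0[OF D(2)] by auto
  qed
  then obtain n u0 where "u0 \<in> top_of_set D interior_of C n" by blast
  then obtain T where "openin (top_of_set D) T" "u0 \<in> T" "T \<subseteq> C n"
    unfolding interior_of_def by blast
  then obtain U where U: "open U" "u0 \<in> U" "D \<inter> U \<subseteq> C n" "u0 \<in> D"
    unfolding openin_open by blast
  obtain r where r: "r > 0" "ball u0 r \<subseteq> U"
    using openE[OF U(1,2)] by blast
  \<comment> \<open>The symmetry \<open>u = ((u0 + u) - (u0 - u)) / 2\<close> moves the ball to the origin.\<close>
  have approx: "\<exists>u' v'. u' \<in> D \<and> (u', v') \<in> G \<and> norm v' \<le> real n \<and> norm (u - u') < e"
    if u: "u \<in> D" "norm u < r" and "e > 0" for u e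
  proof -
    have "u0 + u \<in> D" "u0 - u \<in> D"
      using subspace_add[OF D(2)] subspace_diff[OF D(2)] u U by blast+
    moreover have "u0 + u \<in> ball u0 r" "u0 - u \<in> ball u0 r"
      using u by (simp_all add: dist_norm)
    ultimately have "u0 + u \<in> C n" "u0 - u \<in> C n"
      using U(3) r(2) by blast+
    then obtain a b where a: "a \<in> P n" "dist a (u0 + u) < e" and b: "b \<in> P n" "dist b (u0 - u) < e"
      using \<open>e > 0\<close> unfolding C_def closure_approachable by blast
    from a b obtain v w where vw: "(a, v) \<in> G" "norm v \<le> real n" "(b, w) \<in> G" "norm w \<le> real n"
      "a \<in> D" "b \<in> D"
      by (auto simp: P_def)
    have "(a, v) - (b, w) \<in> G"
      using vw subspace_diff[OF G(2)] by blast
    then have "(1/2) *\<^sub>R ((a, v) - (b, w)) \<in> G"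
      using subspace_mul[OF G(2)] by blast
    then have 1: "((1/2) *\<^sub>R (a - b), (1/2) *\<^sub>R (v - w)) \<in> G"
      by simp
    have 2: "(1/2) *\<^sub>R (a - b) \<in> D"
      using vw subspace_diff[OF D(2)] subspace_mul[OF D(2)] by blast
    have 3: "norm ((1/2) *\<^sub>R (v - w)) \<le> real n"
      using vw norm_triangle_ineq4[of v w] by simp
    have "u - (1/2) *\<^sub>R (a - b) = (1/2) *\<^sub>R (((u0 + u) - a) - ((u0 - u) - b))"
      by (simp add: algebra_simps flip: scaleR_add_left)
    then have "norm (u - (1/2) *\<^sub>R (a - b)) = norm (((u0 + u) - a) - ((u0 - u) - b)) / 2"
      by simp
    also have "\<dots> \<le> (norm ((u0 + u) - a) + norm ((u0 - u) - b)) / 2"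
      using norm_triangle_ineq4[of "(u0 + u) - a" "(u0 - u) - b"] by simp
    also have "\<dots> < e"
      using a b by (simp add: dist_norm norm_minus_commute)
    finally show ?thesis
      using 1 2 3 by blast
  qed
  define c where "c = 2 * real n / r"
  have c: "c \<ge> 0"
    using r by (simp add: c_def)
  \<comment> \<open>Rescaling to norm \<open>r / 2\<close> and approximating up to a relative error of one half.\<close>
  have step: "\<exists>u' v'. u' \<in> D \<and> (u', v') \<in> G \<and> norm v' \<le> c * norm u \<and> norm (u - u') \<le> norm u / 2"
    if u: "u \<in> D" for u
  proof (cases "u = 0")
    case True
    then show ?thesis
      using subspace_0[OF D(2)] subspace_0[OF G(2)] by (intro exI[of _ 0]) (auto simp: zero_prod_def)
  next
    case False
    define t where "t = r / (2 * norm u)"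
    have t: "t > 0"
      using r False by (simp add: t_def)
    have "t *\<^sub>R u \<in> D" "norm (t *\<^sub>R u) < r" "t * norm u / 2 > 0"
      using u subspace_mul[OF D(2)] False r t by (auto simp: t_def)
    from approx[OF this] obtain u' v' where uv: "u' \<in> D" "(u', v') \<in> G" "norm v' \<le> real n"
      "norm (t *\<^sub>R u - u') < t * norm u / 2"
      by blast
    have 1: "inverse t *\<^sub>R u' \<in> D"
      using uv subspace_mul[OF D(2)] by blast
    have 2: "(inverse t *\<^sub>R u', inverse t *\<^sub>R v') \<in> G"
      using uv subspace_mul[OF G(2), of "(u', v')" "inverse t"] by simp
    have 3: "norm (inverse t *\<^sub>R v') \<le> c * norm u"
      using uv(3) r False by (simp add: t_def c_def divide_simps)
    have "u - inverse t *\<^sub>R u' = inverse t *\<^sub>R (t *\<^sub>R u - u')"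
      using t by (simp add: algebra_simps)
    then have "norm (u - inverse t *\<^sub>R u') = inverse t * norm (t *\<^sub>R u - u')"
      using t by simp
    also have "\<dots> \<le> norm u / 2"
      using uv(4) t by (simp add: field_simps)
    finally show ?thesis
      using 1 2 3 by blast
  qed
  then obtain f g where fg: "\<And>u. u \<in> D \<Longrightarrow> f u \<in> D \<and> (f u, g u) \<in> G \<and> norm (g u) \<le> c * norm u
      \<and> norm (u - f u) \<le> norm u / 2"
    by metis
  have "\<exists>v. (u, v) \<in> G \<and> norm v \<le> (2 * c) * norm u" if u: "u \<in> D" for u
  proof -
    \<comment> \<open>The remainders \<open>x k\<close> of the approximation halve at every step, so the partners sum up.\<close>
    define x where "x = rec_nat u (\<lambda>_ y. y - f y)"
    have x_simps: "x 0 = u" "\<And>k. x (Suc k) = x k - f (x k)"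
      by (auto simp: x_def)
    have xD: "x k \<in> D" for k
      by (induction k) (use u fg subspace_diff[OF D(2)] in \<open>auto simp: x_simps\<close>)
    have x_norm: "norm (x k) \<le> norm u * (1/2) ^ k" for k
    proof (induction k)
      case (Suc k)
      have "norm (x (Suc k)) \<le> norm (x k) / 2"
        using fg[OF xD] by (simp add: x_simps)
      with Suc show ?case
        by simp
    qed (simp add: x_simps)
    have g_norm: "norm (g (x k)) \<le> c * norm u * (1/2) ^ k" for k
    proof -
      have "norm (g (x k)) \<le> c * norm (x k)"
        using fg[OF xD] by blast
      also have "\<dots> \<le> c * (norm u * (1/2) ^ k)"
        by (rule mult_left_mono[OF x_norm c])
      finally show ?thesis by simp
    qed
    have geo: "(\<lambda>k. c * norm u * (1/2) ^ k) sums (c * norm u * 2)"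
      using geometric_sums[of "1/2::real"] by (intro sums_mult) simp
    have summ: "summable (\<lambda>k. g (x k))"
      by (rule summable_comparison_test'[OF sums_summable[OF geo]]) (use g_norm in auto)
    have "(u - x k, \<Sum>i<k. g (x i)) \<in> G" for k
    proof (induction k)
      case 0
      then show ?case
        using subspace_0[OF G(2)] by (simp add: x_simps zero_prod_def)
    next
      case (Suc k)
      have "(u - x k, \<Sum>i<k. g (x i)) + (f (x k), g (x k)) \<in> G"
        using Suc fg[OF xD] subspace_add[OF G(2)] by blast
      then show ?case
        by (simp add: x_simps algebra_simps)
    qed
    moreover have "x \<longlonglongrightarrow> 0"
      by (rule Lim_null_comparison[of _ "\<lambda>k. norm u * (1/2) ^ k"])
        (use x_norm in \<open>auto intro!: tendsto_mult_right_zero LIMSEQ_power_zero\<close>)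
    then have "(\<lambda>k. (u - x k, \<Sum>i<k. g (x i))) \<longlonglongrightarrow> (u - 0, \<Sum>i. g (x i))"
      by (intro tendsto_intros summable_LIMSEQ summ)
    ultimately have "(u, \<Sum>i. g (x i)) \<in> G"
      using closed_sequentially[OF G(1)] by force
    moreover have "norm (\<Sum>i. g (x i)) \<le> 2 * c * norm u"
    proof -
      have "norm (\<Sum>i. g (x i)) \<le> (\<Sum>i. c * norm u * (1/2) ^ i)"
        by (rule norm_suminf_le[OF g_norm sums_summable[OF geo]])
      then show ?thesis
        using sums_unique[OF geo] by simp
    qed
    ultimately show ?thesis by blast
  qed
  then show ?thesis by blast
qed

section \<open>Backward orbits and the single valued extension property\<close>

text \<open>Termwise differentiation; the derivatives are dominated by those of a geometric series of
  ratio \<open>\<rho> * K\<close>.\<close>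

lemma vanalytic_power_series:
  fixes y :: "nat \<Rightarrow> 'a::complex_banach"
  assumes bound: "\<And>n. norm (y n) \<le> c * K ^ n" and K: "K > 0" and \<rho>: "0 < \<rho>" "\<rho> * K < 1"
  shows "\<exists>f. vanalytic_on f (ball z \<rho>) \<and> (\<forall>\<mu>\<in>ball z \<rho>. (\<lambda>n. (\<mu> - z) ^ n *\<^sub>C y n) sums f \<mu>)"
proof -
  define S where "S = ball z \<rho>"
  define d where "d n \<mu> = (of_nat n * (\<mu> - z) ^ (n - 1)) *\<^sub>C y n" for n \<mu>
  have c: "c \<ge> 0"
    using order_trans[OF norm_ge_zero bound[of 0]] by simp
  have "summable (\<lambda>n. diffs (\<lambda>_. 1) n * (\<rho> * K) ^ n :: real)"
  proof (rule termdiff_converges)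
    show "norm (\<rho> * K) < 1" using \<rho> K by simp
    show "\<And>x::real. norm x < 1 \<Longrightarrow> summable (\<lambda>n. 1 * x ^ n)"
      by (simp add: summable_geometric)
  qed
  then have "summable (\<lambda>n. (c * K) * (real (Suc n) * (\<rho> * K) ^ n))"
    by (intro summable_mult) (simp add: diffs_def)
  also have "(\<lambda>n. (c * K) * (real (Suc n) * (\<rho> * K) ^ n))
    = (\<lambda>n. real (Suc n) * \<rho> ^ (Suc n - 1) * (c * K ^ Suc n))"
    by (simp add: fun_eq_iff power_mult_distrib)
  finally have summ: "summable (\<lambda>n. real n * \<rho> ^ (n - 1) * (c * K ^ n))"
    by (subst (asm) summable_Suc_iff)
  have d_bound: "norm (d n \<mu>) \<le> real n * \<rho> ^ (n - 1) * (c * K ^ n)" if "\<mu> \<in> S" for n \<mu>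
  proof -
    have "norm (d n \<mu>) = real n * cmod (\<mu> - z) ^ (n - 1) * norm (y n)"
      by (simp add: d_def norm_scaleC norm_mult norm_power)
    also have "\<dots> \<le> real n * \<rho> ^ (n - 1) * (c * K ^ n)"
      using that bound[of n] by (intro mult_mono power_mono)
        (auto simp: S_def dist_norm norm_minus_commute intro!: mult_nonneg_nonneg zero_le_power order.strict_implies_order[OF \<rho>(1)])
    finally show ?thesis .
  qed
  have unif: "uniform_limit S (\<lambda>n \<mu>. \<Sum>i<n. d i \<mu>) (\<lambda>\<mu>. \<Sum>i. d i \<mu>) sequentially"
    by (rule Weierstrass_m_test[OF d_bound summ])
  have "\<exists>f. \<forall>\<mu>\<in>S. (\<lambda>n. (\<mu> - z) ^ n *\<^sub>C y n) sums f \<mu> \<and>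
      (f has_derivative (\<lambda>h. h *\<^sub>C (\<Sum>i. d i \<mu>))) (at \<mu> within S)"
  proof (rule has_derivative_series[where f' = "\<lambda>n \<mu> h. h *\<^sub>C d n \<mu>"])
    show "convex S" by (simp add: S_def)
    show "z \<in> S" using \<rho> by (simp add: S_def)
    show "(\<lambda>n. (z - z) ^ n *\<^sub>C y n) sums y 0"
      using sums_If_finite[of "\<lambda>n. n = 0" y] by (auto simp: power_0_left if_distrib[of "\<lambda>c. c *\<^sub>C _"] cong: if_cong)
    fix n \<mu> assume "\<mu> \<in> S"
    have "((\<lambda>\<mu>. (\<mu> - z) ^ n) has_derivative (\<lambda>h. h * (of_nat n * (\<mu> - z) ^ (n - 1)))) (at \<mu> within S)"
      by (auto intro!: derivative_eq_intros simp: has_field_derivative_def mult_ac)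
    from bounded_linear.has_derivative[OF bounded_bilinear.bounded_linear_left[OF bounded_bilinear_scaleC, of "y n"] this]
    show "((\<lambda>\<mu>. (\<mu> - z) ^ n *\<^sub>C y n) has_derivative (\<lambda>h. h *\<^sub>C d n \<mu>)) (at \<mu> within S)"
      by (simp add: d_def scaleC_scaleC)
  next
    fix e :: real assume "e > 0"
    from uniform_limitD[OF unif this]
    show "\<forall>\<^sub>F n in sequentially. \<forall>\<mu>\<in>S. \<forall>h. norm ((\<Sum>i<n. h *\<^sub>C d i \<mu>) - h *\<^sub>C (\<Sum>i. d i \<mu>)) \<le> e * norm h"
    proof eventually_elim
      case (elim n)
      show ?case
      proof (intro ballI allI)
        fix \<mu> h assume "\<mu> \<in> S"
        have "norm ((\<Sum>i<n. h *\<^sub>C d i \<mu>) - h *\<^sub>C (\<Sum>i. d i \<mu>)) = norm h * norm ((\<Sum>i<n. d i \<mu>) - (\<Sum>i. d i \<mu>))"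
          by (simp add: norm_scaleC flip: complex_vector.scale_sum_right complex_vector.scale_right_diff_distrib)
        also have "\<dots> \<le> norm h * e"
          using elim \<open>\<mu> \<in> S\<close> by (intro mult_left_mono) (auto simp: dist_norm less_imp_le)
        finally show "norm ((\<Sum>i<n. h *\<^sub>C d i \<mu>) - h *\<^sub>C (\<Sum>i. d i \<mu>)) \<le> e * norm h"
          by (simp add: mult.commute)
      qed
    qed
  qed
  then obtain f where f: "\<And>\<mu>. \<mu> \<in> S \<Longrightarrow> (\<lambda>n. (\<mu> - z) ^ n *\<^sub>C y n) sums f \<mu>"
      "\<And>\<mu>. \<mu> \<in> S \<Longrightarrow> (f has_derivative (\<lambda>h. h *\<^sub>C (\<Sum>i. d i \<mu>))) (at \<mu> within S)"
    by blast
  have "vanalytic_on f S"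
    unfolding vanalytic_on_def
  proof
    fix \<mu> assume "\<mu> \<in> S"
    then have "at \<mu> within S = at \<mu>"
      by (intro at_within_open) (auto simp: S_def)
    then show "\<exists>d. (f has_derivative (\<lambda>h. h *\<^sub>C d)) (at \<mu>)"
      using f(2)[OF \<open>\<mu> \<in> S\<close>] by auto
  qed
  then show ?thesis
    using f(1) S_def by blast
qed

text \<open>A backward orbit is the coefficient sequence of a local analytic solution of
  \<open>(B - \<mu>) f \<mu> = 0\<close> with value \<open>y 0\<close> at \<open>z\<close>.\<close>

lemma SVEP_backward_orbit_trivial:
  fixes B :: "'a::complex_banach \<Rightarrow> 'a"
  assumes B: "bounded_clinear B" and svep: "SVEP_at B z"
    and orbit: "shift B z (y 0) = 0" "\<And>n. shift B z (y (Suc n)) = y n"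
    and bound: "\<And>n. norm (y n) \<le> c * K ^ n"
  shows "y 0 = 0"
proof -
  interpret B: bounded_linear B
    using B by (simp add: bounded_clinear_def)
  have c: "c \<ge> 0"
    using order_trans[OF norm_ge_zero bound[of 0]] by simp
  have bound': "norm (y n) \<le> c * (\<bar>K\<bar> + 1) ^ n" for n
  proof -
    have "K ^ n \<le> \<bar>K\<bar> ^ n"
      by (metis abs_ge_self power_abs)
    also have "\<dots> \<le> (\<bar>K\<bar> + 1) ^ n"
      by (intro power_mono) auto
    finally show ?thesis
      using bound[of n] c by (meson mult_left_mono order_trans)
  qed
  from svep obtain r where r: "r > 0" and ext: "\<forall>V. open V \<and> V \<subseteq> ball z r \<longrightarrow>
      (\<forall>f. vanalytic_on f V \<and> (\<forall>\<mu>\<in>V. shift B \<mu> (f \<mu>) = 0) \<longrightarrow> (\<forall>\<mu>\<in>V. f \<mu> = 0))"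
    unfolding SVEP_at_def by (elim exE conjE)
  \<comment> \<open>\<open>K\<close> is replaced by \<open>\<bar>K\<bar> + 1\<close>, which is positive, and the radius is halved to stay inside
    the disc of convergence.\<close>
  define \<rho> where "\<rho> = min r (1 / (2 * (\<bar>K\<bar> + 1)))"
  have "\<rho> * (\<bar>K\<bar> + 1) \<le> 1 / (2 * (\<bar>K\<bar> + 1)) * (\<bar>K\<bar> + 1)"
    by (intro mult_right_mono) (auto simp: \<rho>_def)
  also have "\<dots> = 1 / 2"
    by (simp add: divide_simps)
  finally have \<rho>: "\<rho> > 0" "\<rho> * (\<bar>K\<bar> + 1) < 1"
    using r by (auto simp: \<rho>_def)
  have "\<bar>K\<bar> + 1 > 0"
    by simp
  from vanalytic_power_series[of y c, OF bound' this \<rho>]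
  obtain f where f: "vanalytic_on f (ball z \<rho>)"
      "\<And>\<mu>. \<mu> \<in> ball z \<rho> \<Longrightarrow> (\<lambda>n. (\<mu> - z) ^ n *\<^sub>C y n) sums f \<mu>"
    by blast
  have "shift B \<mu> (f \<mu>) = 0" if \<mu>: "\<mu> \<in> ball z \<rho>" for \<mu>
  proof -
    define t where "t = \<mu> - z"
    define u where "u n = t ^ n *\<^sub>C y n" for n
    have u: "u sums f \<mu>"
      using f(2)[OF \<mu>] by (simp add: u_def[abs_def] t_def)
    have Bu: "shift B z (u n) = t ^ n *\<^sub>C shift B z (y n)" for n
      using B by (simp add: shift_def u_def bounded_clinear_def scaleC_scaleC mult.commute
          complex_vector.scale_right_diff_distrib)
    \<comment> \<open>\<open>B - z\<close> shifts the series by one place, which is multiplication by \<open>\<mu> - z\<close>.\<close>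
    have "(\<lambda>n. shift B z (u n)) sums (shift B z (f \<mu>))"
      unfolding shift_def
      by (intro sums_diff B.sums[OF u] bounded_linear.sums[OF _ u]
          bounded_bilinear.bounded_linear_right[OF bounded_bilinear_scaleC])
    then have "(\<lambda>n. shift B z (u (Suc n))) sums (shift B z (f \<mu>))"
      using Bu[of 0] orbit(1) by (subst sums_Suc_iff) simp
    moreover have "(\<lambda>n. shift B z (u (Suc n))) = (\<lambda>n. t *\<^sub>C u n)"
      unfolding Bu by (simp add: orbit u_def scaleC_scaleC)
    moreover have "(\<lambda>n. t *\<^sub>C u n) sums (t *\<^sub>C f \<mu>)"
      by (intro bounded_linear.sums[OF _ u] bounded_bilinear.bounded_linear_right[OF bounded_bilinear_scaleC])
    ultimately have "shift B z (f \<mu>) = t *\<^sub>C f \<mu>"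
      using sums_unique2 by metis
    then show ?thesis
      by (simp add: shift_def t_def complex_vector.scale_left_diff_distrib)
  qed
  moreover have "open (ball z \<rho>)" "ball z \<rho> \<subseteq> ball z r" "z \<in> ball z \<rho>"
    using \<rho> by (auto simp: \<rho>_def)
  ultimately have "f z = 0"
    using ext f(1) by blast
  moreover have "f z = y 0"
  proof -
    have "(\<lambda>n. (z - z) ^ n *\<^sub>C y n) sums y 0"
      using sums_If_finite[of "\<lambda>n. n = 0" y]
      by (auto simp: power_0_left if_distrib[of "\<lambda>c. c *\<^sub>C _"] cong: if_cong)
    then show ?thesis
      using f(2)[of z] \<rho> sums_unique2 by force
  qed
  ultimately show ?thesis by simp
qed

section \<open>Finite dimension modulo a subspace\<close>

text \<open>The image of \<open>V\<close> in the quotient by the span of \<open>W\<close> lies in a finite-dimensional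
  subspace. With \<open>V = UNIV\<close> this says that \<open>W\<close> has finite codimension, with \<open>W = {}\<close> that
  \<open>V\<close> is finite-dimensional.\<close>

definition finite_modulo :: "'a::complex_normed_vector set \<Rightarrow> 'a set \<Rightarrow> bool" where
  "finite_modulo W V \<longleftrightarrow> (\<exists>F. finite F \<and> V \<subseteq> cspan (W \<union> F))"

lemma cspan_csubspace: "csubspace W \<Longrightarrow> cspan W = W"
  by simp

lemma csubspace_scale_iff:
  assumes "csubspace W"
  shows "c *\<^sub>C s \<in> W \<longleftrightarrow> c = 0 \<or> s \<in> W"
proof
  assume "c *\<^sub>C s \<in> W"
  then have "inverse c *\<^sub>C c *\<^sub>C s \<in> W"
    by (rule complex_vector.subspace_scale[OF assms])
  then show "c = 0 \<or> s \<in> W"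
    by (cases "c = 0") (simp_all add: scaleC_scaleC)
qed (use assms in \<open>auto simp: complex_vector.subspace_0 complex_vector.subspace_scale\<close>)

lemma mem_cspan_Un_csubspace:
  assumes "csubspace W"
  shows "x \<in> cspan (W \<union> F) \<longleftrightarrow> (\<exists>w\<in>W. x - w \<in> cspan F)"
proof -
  show ?thesis
    unfolding complex_vector.span_Un cspan_csubspace[OF assms]
  proof safe
    fix w assume "w \<in> W" "x - w \<in> cspan F"
    then show "\<exists>w f. x = w + f \<and> w \<in> W \<and> f \<in> cspan F"
      by (intro exI[of _ w] exI[of _ "x - w"]) auto
  qed force
qed

lemma finite_modulo_trans:
  assumes "finite_modulo U W" "finite_modulo W V"
  shows "finite_modulo U V"
proof -
  obtain F F' where F: "finite F" "W \<subseteq> cspan (U \<union> F)" and F': "finite F'" "V \<subseteq> cspan (W \<union> F')"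
    using assms unfolding finite_modulo_def by blast
  have "W \<union> F' \<subseteq> cspan (U \<union> (F \<union> F'))"
    using F(2) complex_vector.span_mono[of "U \<union> F" "U \<union> (F \<union> F')"]
    by (auto intro: complex_vector.span_base)
  then have "cspan (W \<union> F') \<subseteq> cspan (U \<union> (F \<union> F'))"
    by (simp add: complex_vector.span_minimal)
  with F' F(1) show ?thesis
    unfolding finite_modulo_def by (intro exI[of _ "F \<union> F'"]) blast
qed

lemma finite_modulo_mono:
  assumes "finite_modulo W V" "W \<subseteq> W'" "V' \<subseteq> V"
  shows "finite_modulo W' V'"
proof -
  obtain F where F: "finite F" "V \<subseteq> cspan (W \<union> F)"
    using assms(1) unfolding finite_modulo_def by blast
  moreover have "cspan (W \<union> F) \<subseteq> cspan (W' \<union> F)"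
    using assms(2) by (intro complex_vector.span_mono) auto
  ultimately show ?thesis
    using assms(3) unfolding finite_modulo_def by blast
qed

lemma finite_modulo_refl: "finite_modulo W W"
  unfolding finite_modulo_def by (intro exI[of _ "{}"]) (auto intro: complex_vector.span_base)

lemma finite_modulo_image:
  assumes "clinear L" "finite_modulo W V"
  shows "finite_modulo (L ` W) (L ` V)"
proof -
  obtain F where F: "finite F" "V \<subseteq> cspan (W \<union> F)"
    using assms(2) unfolding finite_modulo_def by blast
  then have "L ` V \<subseteq> cspan (L ` W \<union> L ` F)"
    using clinear_image_cspan[OF assms(1), of "W \<union> F"] by (auto simp: image_Un)
  with F show ?thesis
    unfolding finite_modulo_def by blast
qed

lemma finite_modulo_cspan_Un:
  assumes "finite_modulo W V" "finite_modulo W V'" "U \<subseteq> cspan (V \<union> V')"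
  shows "finite_modulo W U"
proof -
  obtain F F' where F: "finite F" "V \<subseteq> cspan (W \<union> F)" and F': "finite F'" "V' \<subseteq> cspan (W \<union> F')"
    using assms unfolding finite_modulo_def by blast
  have "cspan (W \<union> F) \<subseteq> cspan (W \<union> (F \<union> F'))" "cspan (W \<union> F') \<subseteq> cspan (W \<union> (F \<union> F'))"
    by (intro complex_vector.span_mono; blast)+
  with F F' have "cspan (V \<union> V') \<subseteq> cspan (W \<union> (F \<union> F'))"
    by (intro complex_vector.span_minimal) auto
  with assms(3) F(1) F'(1) show ?thesis
    unfolding finite_modulo_def by (intro exI[of _ "F \<union> F'"]) blast
qed

text \<open>\<open>L\<close> induces an injection of \<open>D / L\<^sup>-\<^sup>1(W)\<close> into the quotient of the space by \<open>W\<close>. The proof adds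
  the generators of \<open>L ` D\<close> modulo \<open>W\<close> to \<open>W\<close> one at a time; each enlarges the preimage by at most one
  dimension.\<close>

lemma finite_modulo_vimage:
  assumes L: "clinear L" and D: "csubspace D"
    and W: "csubspace W" "finite_modulo W (L ` D)"
  shows "finite_modulo {x \<in> D. L x \<in> W} D"
proof -
  have "finite_modulo {x \<in> D. L x \<in> W} D"
    if "finite F" "csubspace W" "L ` D \<subseteq> cspan (W \<union> F)" for F W
    using that
  proof (induction F arbitrary: W rule: finite_induct)
    case empty
    have "D = {x \<in> D. L x \<in> W}"
      using empty by (auto simp: cspan_csubspace)
    then show ?case
      using finite_modulo_refl by metis
  next
    case (insert s F)
    define W' where "W' = cspan (insert s W)"
    have "cspan (W \<union> insert s F) \<subseteq> cspan (W' \<union> F)"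
      unfolding W'_def by (intro complex_vector.span_minimal) (auto intro: complex_vector.span_base)
    then have 1: "finite_modulo {x \<in> D. L x \<in> W'} D"
      using insert by (intro insert.IH) (auto simp: W'_def)
    have W': "\<exists>c. L x - c *\<^sub>C s \<in> W" if "L x \<in> W'" for x
      using that insert.prems(1) unfolding W'_def complex_vector.span_breakdown_eq
      by (simp add: cspan_csubspace)
    have 2: "finite_modulo {x \<in> D. L x \<in> W} {x \<in> D. L x \<in> W'}"
    proof (cases "\<exists>x0\<in>D. L x0 \<in> W' \<and> L x0 \<notin> W")
      case False
      then have "{x \<in> D. L x \<in> W'} \<subseteq> {x \<in> D. L x \<in> W}" by auto
      then show ?thesis
        using finite_modulo_mono[OF finite_modulo_refl subset_refl] by blast
    next
      case True
      then obtain x0 c where x0: "x0 \<in> D" "L x0 \<notin> W" "L x0 - c *\<^sub>C s \<in> W"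
        using W' by blast
      then have "c \<noteq> 0" by auto
      have "x \<in> cspan ({x \<in> D. L x \<in> W} \<union> {x0})" if x: "x \<in> D" "L x \<in> W'" for x
      proof -
        obtain d where d: "L x - d *\<^sub>C s \<in> W"
          using W' x by blast
        define e where "e = d / c"
        have "(L x - d *\<^sub>C s) - e *\<^sub>C (L x0 - c *\<^sub>C s) \<in> W"
          by (rule complex_vector.subspace_diff[OF insert.prems(1) d
                complex_vector.subspace_scale[OF insert.prems(1) x0(3)]])
        also have "(L x - d *\<^sub>C s) - e *\<^sub>C (L x0 - c *\<^sub>C s) = L (x - e *\<^sub>C x0)"
          using \<open>c \<noteq> 0\<close> by (simp add: module_hom.diff[OF L] module_hom.scale[OF L] e_def
              complex_vector.scale_right_diff_distrib scaleC_scaleC)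
        finally have "x - e *\<^sub>C x0 \<in> {x \<in> D. L x \<in> W}"
          using D x x0 by (auto intro!: complex_vector.subspace_diff complex_vector.subspace_scale)
        then have "(x - e *\<^sub>C x0) + e *\<^sub>C x0 \<in> cspan ({x \<in> D. L x \<in> W} \<union> {x0})"
          by (intro complex_vector.span_add complex_vector.span_scale) (auto intro: complex_vector.span_base)
        then show ?thesis by simp
      qed
      then show ?thesis
        unfolding finite_modulo_def by (intro exI[of _ "{x0}"]) auto
    qed
    show ?case
      by (rule finite_modulo_trans[OF 2 1])
  qed
  with W show ?thesis
    unfolding finite_modulo_def by blast
qed

text \<open>Induction on a finite set \<open>F\<close> that spans the space modulo \<open>W 0\<close>. An element \<open>s\<close> of \<open>F\<close> either enters
  the chain, which is then followed from there on with one generator less, or never does; then the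
  chain can be recovered from the sums \<open>W n + span {s}\<close>.\<close>

lemma finite_codim_chain_stabilises:
  assumes "\<And>n. csubspace (W n)" "\<And>n. W n \<subseteq> W (Suc n)" "finite_modulo (W 0) UNIV"
  shows "\<exists>d. \<forall>n\<ge>d. W n = W d"
proof -
  have "\<exists>d. \<forall>n\<ge>d. W n = W d"
    if "finite F" "\<And>n. csubspace (W n)" "\<And>n. W n \<subseteq> W (Suc n)" "cspan (W 0 \<union> F) = UNIV" for F W
    using that
  proof (induction F arbitrary: W rule: finite_induct)
    case empty
    have mono: "W 0 \<subseteq> W n" for n
      by (rule lift_Suc_mono_le[of W]) (use empty in auto)
    have "W 0 = UNIV"
      using empty(1)[of 0] empty(3) by (simp add: cspan_csubspace)
    with mono have "W n = UNIV" for n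
      by blast
    then show ?case by auto
  next
    case (insert s F)
    have mono: "W m \<subseteq> W n" if "m \<le> n" for m n
      by (rule lift_Suc_mono_le[of W]) (use insert.prems that in auto)
    show ?case
    proof (cases "\<exists>m. s \<in> W m")
      case True
      then obtain m where m: "s \<in> W m" by blast
      have "W 0 \<union> insert s F \<subseteq> cspan (W m \<union> F)"
        using m mono[of 0 m] by (auto intro: complex_vector.span_base)
      then have "cspan (W 0 \<union> insert s F) \<subseteq> cspan (W m \<union> F)"
        by (intro complex_vector.span_minimal) auto
      then obtain d where d: "\<And>n. n \<ge> d \<Longrightarrow> W (m + n) = W (m + d)"
        using insert.IH[of "\<lambda>n. W (m + n)"] insert.prems by auto
      have "W n = W (m + d)" if "n \<ge> m + d" for n
        using d[of "n - m"] that by simp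
      then show ?thesis by blast
    next
      case False
      define W' where "W' n = cspan (insert s (W n))" for n
      have "cspan (W 0 \<union> insert s F) \<subseteq> cspan (W' 0 \<union> F)"
        unfolding W'_def by (intro complex_vector.span_minimal) (auto intro: complex_vector.span_base)
      moreover have "W' n \<subseteq> W' (Suc n)" for n
        unfolding W'_def using insert.prems(2) by (intro complex_vector.span_mono) auto
      moreover have "csubspace (W' n)" for n
        by (simp add: W'_def)
      ultimately obtain d where d: "\<And>n. n \<ge> d \<Longrightarrow> W' n = W' d"
        using insert.IH[of W'] insert.prems(3) by auto
      have "W n \<subseteq> W d" if "n \<ge> d" for n
      proof
        fix w assume w: "w \<in> W n"
        then have "w \<in> W' d"
          using d[OF that] by (auto simp: W'_def intro: complex_vector.span_base)
        then obtain c where c: "w - c *\<^sub>C s \<in> W d"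
          using insert.prems(1)[of d] unfolding W'_def complex_vector.span_breakdown_eq
            by (auto simp: cspan_csubspace)
        then have "w - c *\<^sub>C s \<in> W n"
          using mono[OF that] by blast
        then have "w - (w - c *\<^sub>C s) \<in> W n"
          by (rule complex_vector.subspace_diff[OF insert.prems(1) w])
        then have "c *\<^sub>C s \<in> W n" by simp
        then have "c = 0"
          using False csubspace_scale_iff[OF insert.prems(1)] by blast
        then show "w \<in> W d"
          using c by simp
      qed
      then show ?thesis
        using mono by (intro exI[of _ d]) blast
    qed
  qed
  with assms show ?thesis
    unfolding finite_modulo_def by blast
qed

lemma finite_codim_complement:
  assumes "csubspace W" "finite_modulo W UNIV"
  obtains F where "finite F" "W \<inter> cspan F = {0}" "cspan (W \<union> F) = UNIV"
proof -
  have "\<exists>F. finite F \<and> W \<inter> cspan F = {0} \<and> cspan (W \<union> F) = UNIV"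
    if "finite F" "csubspace W" "cspan (W \<union> F) = UNIV" for F W
    using that
  proof (induction F arbitrary: W rule: finite_induct)
    case empty
    then show ?case
      by (intro exI[of _ "{}"]) (auto simp: complex_vector.subspace_0)
  next
    case (insert s F)
    define W' where "W' = cspan (insert s W)"
    have "cspan (W \<union> insert s F) \<subseteq> cspan (W' \<union> F)"
      unfolding W'_def by (intro complex_vector.span_minimal) (auto intro: complex_vector.span_base)
    then obtain G where G: "finite G" "W' \<inter> cspan G = {0}" "cspan (W' \<union> G) = UNIV"
      using insert.IH[of W'] insert.prems by (auto simp: W'_def)
    show ?case
    proof (cases "s \<in> W")
      case True
      then have "W' = W"
        unfolding W'_def using insert.prems by (simp add: insert_absorb cspan_csubspace)
      with G show ?thesis by blast
    next
      case False
      have "W \<inter> cspan (insert s G) \<subseteq> {0}"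
      proof
        fix x assume x: "x \<in> W \<inter> cspan (insert s G)"
        then obtain c where c: "x - c *\<^sub>C s \<in> cspan G"
          by (auto simp: complex_vector.span_breakdown_eq)
        have "x - c *\<^sub>C s \<in> W'"
          using x unfolding W'_def
          by (intro complex_vector.span_diff complex_vector.span_scale) (auto intro: complex_vector.span_base)
        with c G(2) have "x - c *\<^sub>C s \<in> {0}" by blast
        then have eq: "x = c *\<^sub>C s" by simp
        then have "c = 0"
          using False x csubspace_scale_iff[OF insert.prems(1)] by blast
        with eq show "x \<in> {0}" by simp
      qed
      moreover have "0 \<in> W \<inter> cspan (insert s G)"
        using insert.prems(1) by (simp add: complex_vector.subspace_0 complex_vector.span_zero)
      moreover have "cspan (W' \<union> G) \<subseteq> cspan (W \<union> insert s G)"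
      proof -
        have "W' \<subseteq> cspan (W \<union> insert s G)"
          unfolding W'_def by (intro complex_vector.span_mono) auto
        then show ?thesis
          by (intro complex_vector.span_minimal) (auto intro: complex_vector.span_base)
      qed
      ultimately show ?thesis
        using G by (intro exI[of _ "insert s G"]) auto
    qed
  qed
  then have "\<exists>F. finite F \<and> W \<inter> cspan F = {0} \<and> cspan (W \<union> F) = UNIV"
    using assms unfolding finite_modulo_def by (metis top.extremum_uniqueI)
  with that show ?thesis by blast
qed

text \<open>The coefficient of \<open>a\<close> is bounded by a multiple of the norm, since \<open>a\<close> has positive distance from \<open>W\<close>;
  so it converges along convergent sequences.\<close>

lemma closed_cspan_insert:
  assumes W: "csubspace W" "closed W"
  shows "closed (cspan (insert a W))"
proof (cases "a \<in> W")
  case True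
  then show ?thesis
    using W by (simp add: insert_absorb cspan_csubspace)
next
  case False
  then obtain e where "e > 0" "ball a e \<subseteq> - W"
    using W(2) openE[of "- W" a] by (auto simp: closed_def)
  then have e: "e > 0" "\<And>w. w \<in> W \<Longrightarrow> e \<le> dist a w"
    by (auto simp: subset_iff not_less)
  have lower: "e * cmod k \<le> norm (k *\<^sub>C a + w)" if "w \<in> W" for k w
  proof (cases "k = 0")
    case False
    have "- (inverse k *\<^sub>C w) \<in> W"
      using that W by (intro complex_vector.subspace_neg complex_vector.subspace_scale)
    then have "e \<le> norm (a - (- (inverse k *\<^sub>C w)))"
      using e by (metis dist_norm)
    then have "cmod k * e \<le> cmod k * norm (a + inverse k *\<^sub>C w)"
      by (intro mult_left_mono) auto
    also have "\<dots> = norm (k *\<^sub>C (a + inverse k *\<^sub>C w))"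
      by (simp add: norm_scaleC)
    also have "k *\<^sub>C (a + inverse k *\<^sub>C w) = k *\<^sub>C a + w"
      using False by (simp add: scaleC_add_right scaleC_scaleC)
    finally show ?thesis by (simp add: mult.commute)
  qed simp
  show ?thesis
    unfolding closed_sequential_limits
  proof (intro allI impI, elim conjE)
    fix x l assume x: "\<forall>n::nat. x n \<in> cspan (insert a W)" and l: "x \<longlonglongrightarrow> l"
    then have "\<forall>n. \<exists>k. x n - k *\<^sub>C a \<in> W"
      using W(1) by (simp add: complex_vector.span_breakdown_eq cspan_csubspace)
    then obtain k where k: "\<And>n. x n - k n *\<^sub>C a \<in> W"
      by metis
    have bound: "e * dist (k m) (k n) \<le> dist (x m) (x n)" for m n
    proof -
      have "(x m - k m *\<^sub>C a) - (x n - k n *\<^sub>C a) \<in> W"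
        by (rule complex_vector.subspace_diff[OF W(1) k k])
      from lower[OF this, of "k m - k n"] show ?thesis
        by (simp add: dist_norm complex_vector.scale_left_diff_distrib algebra_simps)
    qed
    have "Cauchy k"
    proof (rule metric_CauchyI)
      fix \<epsilon> :: real assume "\<epsilon> > 0"
      then obtain N where N: "\<And>m n. m \<ge> N \<Longrightarrow> n \<ge> N \<Longrightarrow> dist (x m) (x n) < e * \<epsilon>"
        using metric_CauchyD[OF LIMSEQ_imp_Cauchy[OF l], of "e * \<epsilon>"] e by auto
      have "dist (k m) (k n) < \<epsilon>" if "m \<ge> N" "n \<ge> N" for m n
        using le_less_trans[OF bound N[OF that]] e by simp
      then show "\<exists>N. \<forall>m\<ge>N. \<forall>n\<ge>N. dist (k m) (k n) < \<epsilon>" by blast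
    qed
    then obtain k0 where k0: "k \<longlonglongrightarrow> k0"
      using Cauchy_convergent_iff convergent_def by blast
    have "(\<lambda>n. x n - k n *\<^sub>C a) \<longlonglongrightarrow> l - k0 *\<^sub>C a"
      by (intro tendsto_diff l tendsto_scaleC k0 tendsto_const)
    then have "l - k0 *\<^sub>C a \<in> W"
      by (rule closed_sequentially[OF W(2) k])
    then show "l \<in> cspan (insert a W)"
      using W(1) by (auto simp: complex_vector.span_breakdown_eq cspan_csubspace)
  qed
qed

lemma closed_cspan_Un_finite:
  assumes "finite F" "csubspace W" "closed W"
  shows "closed (cspan (W \<union> F))"
  using assms
proof (induction F arbitrary: W rule: finite_induct)
  case empty
  then show ?case by (simp add: cspan_csubspace)
next
  case (insert s F)
  have "cspan (W \<union> insert s F) = cspan (cspan (insert s W) \<union> F)"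
  proof
    have "cspan (insert s W) \<subseteq> cspan (W \<union> insert s F)"
      by (intro complex_vector.span_mono) auto
    then show "cspan (cspan (insert s W) \<union> F) \<subseteq> cspan (W \<union> insert s F)"
      by (intro complex_vector.span_minimal) (auto intro: complex_vector.span_base)
  qed (intro complex_vector.span_minimal, auto intro: complex_vector.span_base)
  then show ?case
    using insert.IH[of "cspan (insert s W)"] closed_cspan_insert[of W s] insert.prems by simp
qed

lemma closed_cspan_finite:
  fixes F :: "'a::complex_normed_vector set"
  assumes "finite F"
  shows "closed (cspan F)"
proof -
  have "closed (cspan ({0} \<union> F))"
    by (rule closed_cspan_Un_finite[OF assms complex_vector.subspace_single_0 closed_singleton])
  moreover have "cspan ({0} \<union> F) = cspan F"
    using complex_vector.span_insert_0[of F] by simp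
  ultimately show ?thesis
    by metis
qed

section \<open>Kernels and iterated ranges under the single valued extension property\<close>

lemma bounded_clinear_shift:
  assumes "bounded_clinear B"
  shows "bounded_clinear (shift B z)"
proof -
  have "bounded_linear (\<lambda>x. B x - z *\<^sub>C x)"
    using assms by (intro bounded_linear_sub
        bounded_bilinear.bounded_linear_right[OF bounded_bilinear_scaleC])
      (auto simp: bounded_clinear_def)
  then show ?thesis
    using assms by (simp add: bounded_clinear_def shift_def scaleC_scaleC mult.commute
        complex_vector.scale_right_diff_distrib)
qed

text \<open>The hypothesis \<open>lift\<close> says that \<open>B - z\<close> maps \<open>J ` D\<close> onto itself. Preimages with controlled norm are
  chosen upstairs in the closed subspace \<open>D\<close>, so \<open>J ` D\<close> itself need not be closed: this is how
  ranges of powers enter before anything is known about their topology.\<close>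

lemma SVEP_kernel_Int_image_trivial:
  fixes B :: "'y::complex_banach \<Rightarrow> 'y" and J :: "'u::complex_banach \<Rightarrow> 'y"
  assumes B: "bounded_clinear B" and svep: "SVEP_at B z" and J: "bounded_clinear J"
    and D: "csubspace D" "closed D"
    and lift: "\<And>u. u \<in> D \<Longrightarrow> \<exists>u'\<in>D. shift B z (J u') = J u"
  shows "kernel (shift B z) \<inter> J ` D = {0}"
proof -
  define T where "T = shift B z"
  have T: "bounded_clinear T"
    by (simp add: T_def bounded_clinear_shift B)
  interpret T: bounded_linear T
    using T by (simp add: bounded_clinear_def)
  interpret J: bounded_linear J
    using J by (simp add: bounded_clinear_def)
  define G where "G = {(u, u'). u' \<in> D \<and> T (J u') = J u}"
  have clG: "closed G"
  proof -
    have "G = (snd -` D) \<inter> {p. T (J (snd p)) = J (fst p)}"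
      by (auto simp: G_def)
    moreover have "closed (snd -` D :: ('u \<times> 'u) set)"
      by (intro closed_vimage D continuous_intros)
    moreover have "closed {p. T (J (snd p)) = J (fst p)}"
      by (intro closed_Collect_eq T.continuous_on J.continuous_on continuous_intros)
    ultimately show ?thesis
      by (simp add: closed_Int)
  qed
  have subG: "subspace G"
    using csubspace_imp_subspace[OF D(1)]
    by (auto simp: subspace_def G_def zero_prod_def J.zero T.zero J.add T.add J.scaleR T.scaleR)
  have "\<exists>u'. (u, u') \<in> G" if "u \<in> D" for u
    using lift[OF that] by (auto simp: G_def T_def)
  from closed_relation_bounded_selection[OF D(2) csubspace_imp_subspace[OF D(1)] clG subG this]
  obtain K where "\<forall>u\<in>D. \<exists>u'. (u, u') \<in> G \<and> norm u' \<le> K * norm u" ..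
  from bchoice[OF this] obtain h where "\<forall>u\<in>D. (u, h u) \<in> G \<and> norm (h u) \<le> K * norm u" ..
  then have h: "\<And>u. u \<in> D \<Longrightarrow> h u \<in> D" "\<And>u. u \<in> D \<Longrightarrow> T (J (h u)) = J u"
      "\<And>u. u \<in> D \<Longrightarrow> norm (h u) \<le> K * norm u"
    by (auto simp: G_def)
  obtain k where k: "k > 0" "\<And>u. norm (J u) \<le> norm u * k"
    using J.pos_bounded by blast
  have "J u = 0" if u: "u \<in> D" "T (J u) = 0" for u
  proof -
    define x where "x n = (h ^^ n) u" for n
    have xD: "x n \<in> D" for n
      by (induction n) (use u h(1) in \<open>auto simp: x_def\<close>)
    have x_norm: "norm (x n) \<le> norm u * \<bar>K\<bar> ^ n" for n
    proof (induction n)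
      case (Suc n)
      have "norm (x (Suc n)) \<le> K * norm (x n)"
        using h(3)[OF xD] by (simp add: x_def)
      also have "\<dots> \<le> \<bar>K\<bar> * norm (x n)"
        by (intro mult_right_mono) auto
      also have "\<dots> \<le> \<bar>K\<bar> * (norm u * \<bar>K\<bar> ^ n)"
        by (intro mult_left_mono Suc) auto
      finally show ?case by (simp add: mult_ac)
    qed (simp add: x_def)
    have "norm (J (x n)) \<le> (norm u * k) * \<bar>K\<bar> ^ n" for n
    proof -
      have "norm (J (x n)) \<le> norm (x n) * k"
        by (rule k)
      also have "\<dots> \<le> norm u * \<bar>K\<bar> ^ n * k"
        using k by (intro mult_right_mono x_norm) auto
      finally show ?thesis by (simp add: mult_ac)
    qed
    from SVEP_backward_orbit_trivial[OF B svep, of "\<lambda>n. J (x n)", OF _ _ this]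
    have "J (x 0) = 0"
      using u h(2)[OF xD] by (simp add: T_def x_def)
    then show ?thesis by (simp add: x_def)
  qed
  then have "kernel T \<inter> J ` D \<subseteq> {0}"
    by (auto simp: kernel_def)
  moreover have "0 \<in> kernel T \<inter> J ` D"
    using D(1) by (auto simp: kernel_def T.zero intro!: image_eqI[of _ _ 0] simp: J.zero complex_vector.subspace_0)
  ultimately show ?thesis
    unfolding T_def by blast
qed

lemma SVEP_kernel_Int_range_finite_descent:
  fixes B :: "'y::complex_banach \<Rightarrow> 'y"
  assumes B: "bounded_clinear B" and svep: "SVEP_at B z"
    and q: "range (shift B z ^^ q) = range (shift B z ^^ Suc q)"
  shows "kernel (shift B z) \<inter> range (shift B z ^^ q) = {0}"
proof (rule SVEP_kernel_Int_image_trivial[OF B svep])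
  show "bounded_clinear (shift B z ^^ q)"
    by (intro bounded_clinear_funpow bounded_clinear_shift B)
  show "csubspace (UNIV :: 'y set)" "closed (UNIV :: 'y set)"
    by auto
  fix u :: 'y
  have "(shift B z ^^ q) u \<in> range (shift B z ^^ Suc q)"
    using q by blast
  then show "\<exists>u'\<in>UNIV. shift B z ((shift B z ^^ q) u') = (shift B z ^^ q) u"
    by auto
qed

text \<open>\<open>closed_relation_bounded_selection\<close> for the relation \<open>y - T x \<in> cspan F\<close>.\<close>

lemma bounded_solution_modulo_finite:
  fixes T :: "'x::complex_banach \<Rightarrow> 'y::complex_banach"
  assumes T: "bounded_clinear T" and F: "finite F" and D: "csubspace D" "closed D"
    and solvable: "\<And>y. \<exists>x\<in>D. y - T x \<in> cspan F"
  shows "\<exists>K h. \<forall>y. h y \<in> D \<and> y - T (h y) \<in> cspan F \<and> norm (h y) \<le> K * norm y"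
proof -
  interpret T: bounded_linear T
    using T by (simp add: bounded_clinear_def)
  define G where "G = {(y, x). x \<in> D \<and> y - T x \<in> cspan F}"
  have "closed G"
  proof -
    have "G = snd -` D \<inter> (\<lambda>p. fst p - T (snd p)) -` cspan F"
      by (auto simp: G_def)
    also have "closed \<dots>"
      by (intro closed_Int closed_vimage D closed_cspan_finite F continuous_intros T.continuous_on)
    finally show ?thesis .
  qed
  moreover have "subspace G"
    unfolding subspace_def
  proof (intro conjI ballI allI)
    show "0 \<in> G"
      using D by (simp add: G_def zero_prod_def T.zero complex_vector.span_zero complex_vector.subspace_0)
    show "p + q \<in> G" if "p \<in> G" "q \<in> G" for p q
      using that complex_vector.span_add[of "fst p - T (snd p)" F "fst q - T (snd q)"]
        complex_vector.subspace_add[OF D(1)]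
      by (auto simp: G_def T.add algebra_simps)
    show "c *\<^sub>R p \<in> G" if "p \<in> G" for c p
      using that complex_vector.span_scale[of "fst p - T (snd p)" F "complex_of_real c"]
        complex_vector.subspace_scale[OF D(1), of "snd p" "complex_of_real c"]
      by (auto simp: G_def T.scaleR scaleR_diff_right simp flip: scaleR_scaleC)
  qed
  moreover have "\<exists>x. (y, x) \<in> G" for y
    using solvable by (auto simp: G_def)
  ultimately obtain K where "\<forall>y\<in>UNIV. \<exists>x. (y, x) \<in> G \<and> norm x \<le> K * norm y"
    using closed_relation_bounded_selection[of UNIV G] by auto
  from bchoice[OF this] obtain h where "\<forall>y\<in>UNIV. (y, h y) \<in> G \<and> norm (h y) \<le> K * norm y" ..
  then show ?thesis
    by (auto simp: G_def)
qed

text \<open>With an algebraic complement \<open>cspan F\<close> of the range, \<open>T\<close> is solved modulo \<open>cspan F\<close> with norm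
  control, which makes the component in the complement continuous.\<close>

lemma closed_range_finite_codim:
  fixes T :: "'x::complex_banach \<Rightarrow> 'y::complex_banach"
  assumes T: "bounded_clinear T" and fin: "finite_modulo (range T) UNIV"
  shows "closed (range T)"
proof -
  interpret T: bounded_linear T
    using T by (simp add: bounded_clinear_def)
  have R: "csubspace (range T)"
    by (intro csubspace_range bounded_clinear_imp_clinear T)
  obtain F where F: "finite F" "range T \<inter> cspan F = {0}" "cspan (range T \<union> F) = UNIV"
    using finite_codim_complement[OF R fin] by blast
  have solvable: "\<exists>x\<in>UNIV. y - T x \<in> cspan F" for y
    using mem_cspan_Un_csubspace[OF R, of y F] F(3) by auto
  obtain K h where h: "\<And>y. y - T (h y) \<in> cspan F" "\<And>y. norm (h y) \<le> K * norm y"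
    using bounded_solution_modulo_finite[OF T F(1) _ _ solvable] by auto
  show ?thesis
    unfolding closed_sequential_limits
  proof (intro allI impI, elim conjE)
    fix y l assume y: "\<forall>n::nat. y n \<in> range T" and l: "y \<longlonglongrightarrow> l"
    obtain x where x: "l - T x \<in> cspan F"
      using h(1) by blast
    define f where "f n = (y n - l) - T (h (y n - l))" for n
    \<comment> \<open>The component of \<open>y n - l\<close> in the complement does not depend on \<open>n\<close>, yet it tends to \<open>0\<close>.\<close>
    have f: "f n = - (l - T x)" for n
    proof -
      have "f n + (l - T x) = y n - T (h (y n - l)) - T x"
        by (simp add: f_def)
      also have "\<dots> \<in> range T"
        using y R by (intro complex_vector.subspace_diff) auto
      finally have "f n + (l - T x) \<in> range T \<inter> cspan F"
        using complex_vector.span_add[OF h(1)[of "y n - l"] x] by (simp add: f_def)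
      then have "f n + (l - T x) = 0"
        using F(2) by blast
      then show ?thesis
        by (rule eq_neg_iff_add_eq_0[THEN iffD2])
    qed
    have diff0: "(\<lambda>n. y n - l) \<longlonglongrightarrow> 0"
      using l by (simp add: LIM_zero_iff)
    have "(\<lambda>n. h (y n - l)) \<longlonglongrightarrow> 0"
      by (rule Lim_null_comparison[of _ "\<lambda>n. K * norm (y n - l)"])
        (use h(2) diff0 in \<open>auto intro!: tendsto_mult_right_zero tendsto_norm_zero\<close>)
    then have "f \<longlonglongrightarrow> 0"
      unfolding f_def using tendsto_diff[OF diff0 T.tendsto_zero] by simp
    moreover have "f = (\<lambda>n. - (l - T x))"
      using f by (rule ext)
    ultimately have "- (l - T x) = 0"
      by (simp only: LIMSEQ_const_iff)
    then show "l \<in> range T"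
      by auto
  qed
qed

lemma finite_codim_range_funpow:
  fixes T :: "'a::complex_normed_vector \<Rightarrow> 'a"
  assumes T: "clinear T" and fin: "finite_modulo (range T) UNIV"
  shows "finite_modulo (range (T ^^ n)) UNIV"
proof (induction n)
  case 0
  then show ?case
    by (simp add: finite_modulo_refl)
next
  case (Suc n)
  have "finite_modulo (range (T ^^ Suc n)) (range (T ^^ n))"
    using finite_modulo_image[OF clinear_funpow[OF T, of n] fin]
    by (simp only: funpow_Suc_right image_comp)
  then show ?case
    using finite_modulo_trans Suc by blast
qed

text \<open>The spaces \<open>R(T) + N(T\<^sup>n)\<close> increase and contain \<open>R(T)\<close>, so they are constant from some \<open>d\<close> on.
  An element \<open>T\<^sup>n x\<close> of the kernel has \<open>x \<in> N(T\<^sup>n\<^sup>+\<^sup>1)\<close>; for \<open>n \<ge> d\<close> this lies in \<open>R(T) + N(T\<^sup>n)\<close>,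
  so that \<open>T\<^sup>n x \<in> R(T\<^sup>n\<^sup>+\<^sup>1)\<close>.\<close>

lemma kernel_Int_range_funpow_stabilises:
  fixes T :: "'a::complex_normed_vector \<Rightarrow> 'a"
  assumes T: "clinear T" and fin: "finite_modulo (range T) UNIV"
  shows "\<exists>d. \<forall>n. kernel T \<inter> range (T ^^ d) \<subseteq> range (T ^^ n)"
proof -
  note R = csubspace_range[OF T]
  have N: "csubspace (kernel (T ^^ n))" for n
    by (intro csubspace_kernel clinear_funpow T)
  define W where "W n = cspan (range T \<union> kernel (T ^^ n))" for n
  have memW: "x \<in> W n \<longleftrightarrow> (\<exists>w\<in>range T. x - w \<in> kernel (T ^^ n))" for x n
    unfolding W_def mem_cspan_Un_csubspace[OF R] cspan_csubspace[OF N] ..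
  have "W n \<subseteq> W (Suc n)" for n
    unfolding W_def by (intro complex_vector.span_mono) (auto simp: kernel_def module_hom.zero[OF T])
  moreover have "finite_modulo (W 0) UNIV"
    by (rule finite_modulo_mono[OF fin]) (auto simp: W_def intro: complex_vector.span_base)
  moreover have "csubspace (W n)" for n
    by (simp add: W_def)
  ultimately obtain d where d: "\<And>n. n \<ge> d \<Longrightarrow> W n = W d"
    using finite_codim_chain_stabilises[of W] by blast
  have step: "kernel T \<inter> range (T ^^ n) \<subseteq> range (T ^^ Suc n)" if "n \<ge> d" for n
  proof
    fix y assume "y \<in> kernel T \<inter> range (T ^^ n)"
    then obtain x where x: "y = (T ^^ n) x" "T y = 0"
      by (auto simp: kernel_def)
    have "x \<in> W (Suc n)"
      unfolding memW using x by (intro bexI[of _ "T 0"]) (auto simp: kernel_def module_hom.zero[OF T])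
    also have "W (Suc n) = W n"
      using d[of n] d[of "Suc n"] that by simp
    finally obtain u where "(T ^^ n) (x - T u) = 0"
      by (auto simp: memW kernel_def)
    then have "y = (T ^^ Suc n) u"
      using module_hom.diff[OF clinear_funpow[OF T]] x by (simp add: funpow_swap1)
    then show "y \<in> range (T ^^ Suc n)"
      by blast
  qed
  have antimono: "range (T ^^ n) \<subseteq> range (T ^^ m)" if "m \<le> n" for m n
    using funpow_add[of m "n - m" T] that by (auto simp: o_def)
  have "kernel T \<inter> range (T ^^ d) \<subseteq> range (T ^^ (d + n))" for n
  proof (induction n)
    case (Suc n)
    then show ?case
      using step[OF le_add1, of n] unfolding add_Suc_right by blast
  qed simp
  then have "kernel T \<inter> range (T ^^ d) \<subseteq> range (T ^^ n)" for n
    using antimono[of n "d + n"] by (meson le_add2 order_trans)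
  then show ?thesis by blast
qed

text \<open>All ranges \<open>R(T\<^sup>n)\<close> of \<open>T = B - z\<close> are closed. For \<open>d\<close> as in \<open>kernel_Int_range_funpow_stabilises\<close>, \<open>T\<close>
  maps their intersection onto itself, so the intersection meets the kernel only in \<open>0\<close>; within the
  kernel, it agrees with \<open>R(T\<^sup>d)\<close>.\<close>

lemma SVEP_finite_codim_finite_ascent:
  fixes B :: "'y::complex_banach \<Rightarrow> 'y"
  assumes B: "bounded_clinear B" and svep: "SVEP_at B z"
    and fin: "finite_modulo (range (shift B z)) UNIV"
  shows "\<exists>d. kernel (shift B z) \<inter> range (shift B z ^^ d) = {0}"
proof -
  define T where "T = shift B z"
  have bT: "bounded_clinear T"
    by (simp add: T_def bounded_clinear_shift B)
  note T = bounded_clinear_imp_clinear[OF bT]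
  have finT: "finite_modulo (range (T ^^ n)) UNIV" for n
    using finite_codim_range_funpow[OF T] fin by (simp add: T_def)
  obtain d where d: "\<And>n. kernel T \<inter> range (T ^^ d) \<subseteq> range (T ^^ n)"
    using kernel_Int_range_funpow_stabilises[OF T finT[of 1, simplified]] by blast
  define D where "D = (\<Inter>n. range (T ^^ n))"
  have D: "csubspace D" "closed D"
    unfolding D_def
    by (auto intro!: complex_vector.subspace_Inter csubspace_range clinear_funpow T closed_INT
        closed_range_finite_codim bounded_clinear_funpow bT finT)
  have lift: "\<exists>u'\<in>D. T u' = u" if u: "u \<in> D" for u
  proof -
    have "\<forall>n. \<exists>v. u = (T ^^ Suc n) v"
      using u unfolding D_def by blast
    then obtain v where v: "\<And>n. u = (T ^^ Suc n) (v n)"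
      by metis
    define w where "w n = (T ^^ n) (v n)" for n
    have Tw: "T (w n) = u" for n
      using v[of n] by (simp add: w_def)
    have "w d \<in> range (T ^^ n)" for n
    proof (cases "n \<le> d")
      case True
      then show ?thesis
        using funpow_add[of n "d - n" T] by (simp add: w_def)
    next
      case False
      \<comment> \<open>Two preimages of \<open>u\<close> in \<open>R(T^d)\<close> differ by an element of every iterated range.\<close>
      then have "w n \<in> range (T ^^ d)"
        using funpow_add[of d "n - d" T] by (simp add: w_def)
      then have "w d - w n \<in> range (T ^^ d)"
        by (intro complex_vector.subspace_diff csubspace_range clinear_funpow T) (simp add: w_def)
      moreover have "w d - w n \<in> kernel T"
        using Tw by (simp add: kernel_def module_hom.diff[OF T])
      ultimately have "w d - w n \<in> range (T ^^ n)"
        using d by blast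
      then have "(w d - w n) + w n \<in> range (T ^^ n)"
        by (rule complex_vector.subspace_add[OF csubspace_range[OF clinear_funpow[OF T]]]) (simp add: w_def)
      then show ?thesis by simp
    qed
    then show ?thesis
      using Tw by (auto simp: D_def)
  qed
  have "kernel T \<inter> (\<lambda>x. x) ` D = {0}"
    unfolding T_def
    by (rule SVEP_kernel_Int_image_trivial[OF B svep _ D])
      (use lift in \<open>auto simp: bounded_clinear_def bounded_linear_ident T_def\<close>)
  moreover have "kernel T \<inter> range (T ^^ d) \<subseteq> D"
    using d by (auto simp: D_def)
  moreover have "0 \<in> range (T ^^ d)"
    by (intro complex_vector.subspace_0 csubspace_range clinear_funpow T)
  ultimately have "kernel T \<inter> range (T ^^ d) = {0}"
    by auto
  then show ?thesis
    unfolding T_def by blast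
qed

text \<open>The kernel meets the finite-codimensional subspace \<open>R((B - z)\<^sup>d)\<close> only in \<open>0\<close>.\<close>

lemma SVEP_finite_codim_finite_kernel:
  fixes B :: "'y::complex_banach \<Rightarrow> 'y"
  assumes B: "bounded_clinear B" and svep: "SVEP_at B z"
    and fin: "finite_modulo (range (shift B z)) UNIV"
  shows "finite_modulo {} (kernel (shift B z))"
proof -
  define T where "T = shift B z"
  have T: "clinear T"
    by (simp add: T_def bounded_clinear_shift bounded_clinear_imp_clinear B)
  obtain d where d: "kernel T \<inter> range (T ^^ d) = {0}"
    using SVEP_finite_codim_finite_ascent[OF assms] by (auto simp: T_def)
  have "finite_modulo (range (T ^^ d)) ((\<lambda>x. x) ` kernel T)"
    using finite_modulo_mono[OF finite_codim_range_funpow[OF T] subset_refl subset_UNIV] fin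
    by (simp add: T_def)
  from finite_modulo_vimage[OF _ csubspace_kernel[OF T] csubspace_range[OF clinear_funpow[OF T]] this]
  have "finite_modulo {x \<in> kernel T. x \<in> range (T ^^ d)} (kernel T)"
    by (simp add: clinearI)
  then have "finite_modulo {0} (kernel T)"
    using d by (simp add: Int_def)
  moreover have "finite_modulo {} {0 :: 'y}"
    unfolding finite_modulo_def by (intro exI[of _ "{}"]) simp
  ultimately show ?thesis
    unfolding T_def using finite_modulo_trans by blast
qed

section \<open>Finite defect, finite descent and right inverses\<close>

lemma quotient_dim_finite_iff:
  assumes W: "csubspace W"
  shows "quotient_dim W < \<infinity> \<longleftrightarrow> finite_modulo W UNIV"
proof -
  have coset_eq: "coset W x = coset W s \<longleftrightarrow> x - s \<in> W" for x s
  proof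
    assume eq: "coset W x = coset W s"
    have "x \<in> coset W x"
      unfolding coset_def using complex_vector.subspace_0[OF W] by force
    with eq obtain w where "x = s + w" "w \<in> W"
      by (auto simp: coset_def)
    then show "x - s \<in> W" by simp
  next
    assume xs: "x - s \<in> W"
    have "x + w \<in> coset W s" if "w \<in> W" for w
      unfolding coset_def using complex_vector.subspace_add[OF W xs that]
      by (auto intro!: exI[of _ "x - s + w"])
    moreover have "s + w \<in> coset W x" if "w \<in> W" for w
      unfolding coset_def using complex_vector.subspace_diff[OF W that xs]
      by (auto intro!: exI[of _ "w - (x - s)"])
    ultimately show "coset W x = coset W s"
      unfolding coset_def by auto
  qed
  have "coset W ` cspan S = range (coset W) \<longleftrightarrow> cspan (W \<union> S) = UNIV" for S
  proof -
    have "coset W ` cspan S = range (coset W) \<longleftrightarrow> range (coset W) \<subseteq> coset W ` cspan S"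
      by blast
    also have "\<dots> \<longleftrightarrow> (\<forall>x. \<exists>s\<in>cspan S. x - s \<in> W)"
      by (simp add: image_subset_iff image_iff coset_eq)
    also have "\<dots> \<longleftrightarrow> (\<forall>x. \<exists>w\<in>W. x - w \<in> cspan S)"
    proof (intro all_cong1 iffI; elim bexE)
      fix x s assume "s \<in> cspan S" "x - s \<in> W"
      then show "\<exists>w\<in>W. x - w \<in> cspan S"
        by (intro bexI[of _ "x - s"]) simp_all
    next
      fix x w assume "w \<in> W" "x - w \<in> cspan S"
      then show "\<exists>s\<in>cspan S. x - s \<in> W"
        by (intro bexI[of _ "x - w"]) simp_all
    qed
    also have "\<dots> \<longleftrightarrow> cspan (W \<union> S) = UNIV"
      by (auto simp: mem_cspan_Un_csubspace[OF W, symmetric])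
    finally show ?thesis .
  qed
  then show ?thesis
    unfolding quotient_dim_def finite_modulo_def Inf_less_iff by auto
qed

lemma defect_finite_iff: "clinear T \<Longrightarrow> defect T < \<infinity> \<longleftrightarrow> finite_modulo (range T) UNIV"
  unfolding defect_def by (intro quotient_dim_finite_iff csubspace_range)

lemma descent_finite_iff: "descent T < \<infinity> \<longleftrightarrow> (\<exists>k. range (T ^^ k) = range (T ^^ Suc k))"
  unfolding descent_def Inf_less_iff by auto

lemma descent_infinite_iff: "descent T = \<infinity> \<longleftrightarrow> \<not> descent T < \<infinity>"
  by simp

text \<open>Right inverses up to the finite rank error \<open>I - T S\<close> with values in \<open>cspan F\<close>. The set \<open>F\<close> is kept
  explicit so that \<open>F = {}\<close> gives exact right inverses and one calculation serves both cases.\<close>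

definition right_inverse_modulo ::
    "'y set \<Rightarrow> ('x::complex_normed_vector \<Rightarrow> 'y::complex_normed_vector) \<Rightarrow> ('y \<Rightarrow> 'x) \<Rightarrow> bool" where
  "right_inverse_modulo F T S \<longleftrightarrow> bounded_clinear S \<and> (\<forall>y. y - T (S y) \<in> cspan F)"

lemma right_invertible_iff: "right_invertible T \<longleftrightarrow> (\<exists>S. right_inverse_modulo {} T S)"
  unfolding right_invertible_def right_inverse_modulo_def by (auto simp: fun_eq_iff)

lemma right_inverse_modulo_range:
  assumes T: "clinear T" and S: "right_inverse_modulo F T S" and F: "finite F"
  shows "finite_modulo (range T) UNIV"
proof -
  have "y \<in> cspan (range T \<union> F)" for y
    using S unfolding mem_cspan_Un_csubspace[OF csubspace_range[OF T]] right_inverse_modulo_def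
    by blast
  with F show ?thesis
    unfolding finite_modulo_def by blast
qed

text \<open>Let \<open>D\<close> be a closed complement of \<open>N(T)\<close> and \<open>cspan F\<close> one of \<open>R(T)\<close>. Then \<open>S y\<close> is the
  unique element of \<open>D\<close> with \<open>y - T (S y) \<in> cspan F\<close>; uniqueness makes \<open>S\<close> linear.\<close>

lemma complemented_kernel_imp_right_inverse_modulo:
  fixes T :: "'x::complex_banach \<Rightarrow> 'y::complex_banach"
  assumes T: "bounded_clinear T" and compl: "complemented (kernel T)"
    and fin: "finite_modulo (range T) UNIV"
  shows "\<exists>F S. finite F \<and> right_inverse_modulo F T S"
proof -
  note lin = bounded_clinear_imp_clinear[OF T]
  note R = csubspace_range[OF lin]
  obtain D where D: "csubspace D" "closed D" "kernel T \<inter> D = {0}"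
      "{u + v |u v. u \<in> kernel T \<and> v \<in> D} = UNIV"
    using compl unfolding complemented_def by blast
  obtain F where F: "finite F" "range T \<inter> cspan F = {0}" "cspan (range T \<union> F) = UNIV"
    using finite_codim_complement[OF R fin] by blast
  have solvable: "\<exists>x\<in>D. y - T x \<in> cspan F" for y
  proof -
    obtain x where x: "y - T x \<in> cspan F"
      using mem_cspan_Un_csubspace[OF R, of y F] F(3) by auto
    have "x \<in> {u + v |u v. u \<in> kernel T \<and> v \<in> D}"
      unfolding D by blast
    then obtain u v where "x = u + v" "u \<in> kernel T" "v \<in> D"
      by blast
    with x show ?thesis
      by (auto simp: module_hom.add[OF lin] kernel_def)
  qed
  have unique: "x = x'" if "x \<in> D" "y - T x \<in> cspan F" "x' \<in> D" "y - T x' \<in> cspan F" for x x' y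
  proof -
    have "(y - T x') - (y - T x) \<in> cspan F"
      by (rule complex_vector.span_diff[OF that(4,2)])
    then have "T (x - x') \<in> cspan F"
      by (simp add: module_hom.diff[OF lin])
    then have "T (x - x') = 0"
      using F(2) by blast
    then have "x - x' \<in> kernel T \<inter> D"
      using complex_vector.subspace_diff[OF D(1)] that by (simp add: kernel_def)
    then have "x - x' \<in> {0}"
      unfolding D(3) .
    then show ?thesis by simp
  qed
  obtain K S where S: "\<And>y. S y \<in> D" "\<And>y. y - T (S y) \<in> cspan F" "\<And>y. norm (S y) \<le> K * norm y"
    using bounded_solution_modulo_finite[OF T F(1) D(1,2) solvable] by blast
  have add: "S (y + y') = S y + S y'" for y y'
  proof (rule unique[of _ "y + y'"])
    show "S y + S y' \<in> D"
      by (intro complex_vector.subspace_add D S)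
    show "y + y' - T (S y + S y') \<in> cspan F"
      using complex_vector.span_add[OF S(2)[of y] S(2)[of y']]
      by (simp add: module_hom.add[OF lin] algebra_simps)
  qed (rule S)+
  have scale: "S (c *\<^sub>C y) = c *\<^sub>C S y" for c y
  proof (rule unique[of _ "c *\<^sub>C y"])
    show "c *\<^sub>C S y \<in> D"
      by (intro complex_vector.subspace_scale D S)
    show "c *\<^sub>C y - T (c *\<^sub>C S y) \<in> cspan F"
      using complex_vector.span_scale[OF S(2)[of y], of c]
      by (simp add: module_hom.scale[OF lin] complex_vector.scale_right_diff_distrib)
  qed (rule S)+
  have "bounded_linear S"
    by (rule bounded_linear_intro[of _ K]) (use add scale S(3) in \<open>auto simp: scaleR_scaleC mult.commute\<close>)
  then have "right_inverse_modulo F T S"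
    unfolding right_inverse_modulo_def bounded_clinear_def using scale S(2) by blast
  with F(1) show ?thesis by blast
qed

text \<open>The elements fixed by \<open>S T\<close> form a closed subspace \<open>W\<close> that meets \<open>N(T)\<close> only in \<open>0\<close>, and
  \<open>N(T) + W\<close> consists of the \<open>x\<close> for which \<open>S\<close> inverts \<open>T\<close> exactly at \<open>T x\<close>. This has finite
  codimension, so adding a finite-dimensional space to \<open>W\<close> completes the complement.\<close>

lemma right_inverse_modulo_imp_complemented_kernel:
  fixes T :: "'x::complex_normed_vector \<Rightarrow> 'y::complex_normed_vector"
  assumes T: "bounded_clinear T" and F: "finite F" and S: "right_inverse_modulo F T S"
  shows "complemented (kernel T)"
proof -
  note lin = bounded_clinear_imp_clinear[OF T]
  have bS: "bounded_clinear S" and S': "\<And>y. y - T (S y) \<in> cspan F"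
    using S by (auto simp: right_inverse_modulo_def)
  note linS = bounded_clinear_imp_clinear[OF bS]
  interpret T: bounded_linear T
    using T by (simp add: bounded_clinear_def)
  interpret S: bounded_linear S
    using bS by (simp add: bounded_clinear_def)
  define L where "L x = T x - T (S (T x))" for x
  have L: "clinear L"
    by (rule clinearI) (simp_all add: L_def T.add S.add module_hom.scale[OF lin] module_hom.scale[OF linS]
        complex_vector.scale_right_diff_distrib)
  \<comment> \<open>On the kernel \<open>V\<close> of the error \<open>L\<close>, \<open>S T\<close> is a projection with kernel \<open>N(T)\<close>.\<close>
  define V where "V = kernel L"
  have V: "csubspace V"
    unfolding V_def by (rule csubspace_kernel[OF L])
  have "finite_modulo {0} (range L)"
    unfolding finite_modulo_def using S' F
    by (intro exI[of _ F]) (auto simp: L_def intro: subsetD[OF complex_vector.span_mono[of F]])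
  from finite_modulo_vimage[OF L _ complex_vector.subspace_single_0 this]
  have "finite_modulo V UNIV"
    by (simp add: V_def kernel_def)
  from finite_codim_complement[OF V this]
  obtain G where G: "finite G" "V \<inter> cspan G = {0}" "cspan (V \<union> G) = UNIV"
    by blast
  define W where "W = {x. S (T x) = x}"
  have "closed W"
    unfolding W_def by (intro closed_Collect_eq S.continuous_on T.continuous_on continuous_intros)
  have W: "csubspace W"
    unfolding W_def complex_vector.subspace_def
    by (auto simp: T.zero S.zero T.add S.add module_hom.scale[OF lin] module_hom.scale[OF linS])
  have WV: "W \<subseteq> V"
    by (auto simp: W_def V_def kernel_def L_def)
  define D where "D = cspan (W \<union> G)"
  have memD: "x \<in> D \<longleftrightarrow> (\<exists>w\<in>W. x - w \<in> cspan G)" for x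
    unfolding D_def by (rule mem_cspan_Un_csubspace[OF W])
  have "kernel T \<inter> D \<subseteq> {0}"
  proof
    fix x assume x: "x \<in> kernel T \<inter> D"
    then obtain w where w: "w \<in> W" "x - w \<in> cspan G"
      using memD by blast
    have "x \<in> V"
      using x by (auto simp: V_def kernel_def L_def S.zero T.zero)
    then have "x - w \<in> V \<inter> cspan G"
      using w WV complex_vector.subspace_diff[OF V] by blast
    then have "x = w"
      using G(2) by simp
    then show "x \<in> {0}"
      using w x by (auto simp: W_def kernel_def S.zero)
  qed
  moreover have "0 \<in> kernel T \<inter> D"
    by (simp add: kernel_def T.zero D_def complex_vector.span_zero)
  moreover have "\<exists>u v. x = u + v \<and> u \<in> kernel T \<and> v \<in> D" for x
  proof -
    have "x \<in> cspan (V \<union> G)"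
      using G(3) by simp
    then obtain v where v: "v \<in> V" "x - v \<in> cspan G"
      using mem_cspan_Un_csubspace[OF V] by blast
    have Tv: "T (S (T v)) = T v"
      using v(1) by (simp add: V_def kernel_def L_def)
    then have "v - S (T v) \<in> kernel T"
      by (simp add: kernel_def T.diff)
    moreover have "S (T v) + (x - v) \<in> D"
      unfolding memD by (rule bexI[of _ "S (T v)"]) (use v(2) Tv in \<open>simp_all add: W_def\<close>)
    moreover have "x = (v - S (T v)) + (S (T v) + (x - v))"
      by simp
    ultimately show ?thesis by blast
  qed
  moreover have "closed D"
    unfolding D_def by (rule closed_cspan_Un_finite[OF G(1) W \<open>closed W\<close>])
  moreover have "csubspace D"
    by (simp add: D_def)
  ultimately show ?thesis
    unfolding complemented_def by (intro exI[of _ D]) (auto simp: set_eq_iff)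
qed

lemma Phi_r_iff:
  fixes T :: "'x::complex_banach \<Rightarrow> 'x"
  assumes "bounded_clinear T"
  shows "T \<in> Phi_r \<longleftrightarrow> (\<exists>F S. finite F \<and> right_inverse_modulo F T S)"
proof
  assume "T \<in> Phi_r"
  then show "\<exists>F S. finite F \<and> right_inverse_modulo F T S"
    using complemented_kernel_imp_right_inverse_modulo[OF assms]
      defect_finite_iff[OF bounded_clinear_imp_clinear[OF assms]]
    by (simp add: Phi_r_def)
next
  assume "\<exists>F S. finite F \<and> right_inverse_modulo F T S"
  then obtain F S where F: "finite F" and S: "right_inverse_modulo F T S"
    by blast
  have "defect T < \<infinity>"
    using right_inverse_modulo_range[OF _ S F] defect_finite_iff bounded_clinear_imp_clinear[OF assms]
    by blast
  then show "T \<in> Phi_r"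
    using assms closed_kernel[OF assms] right_inverse_modulo_imp_complemented_kernel[OF assms F S]
    by (simp add: Phi_r_def)
qed

section \<open>Upper triangular operator matrices\<close>

lemma bounded_clinear_upper_tri:
  assumes "bounded_clinear A" "bounded_clinear B" "bounded_clinear C"
  shows "bounded_clinear (upper_tri A C B)"
proof -
  have "bounded_linear (\<lambda>p. (A (fst p) + C (snd p), B (snd p)))"
    using assms by (intro bounded_linear_Pair bounded_linear_add
        bounded_linear_compose[OF _ bounded_linear_fst] bounded_linear_compose[OF _ bounded_linear_snd])
      (auto simp: bounded_clinear_def)
  with assms show ?thesis
    by (simp add: bounded_clinear_def upper_tri_def scaleC_prod_def scaleC_add_right case_prod_unfold)
qed

lemma clinear_upper_tri:
  assumes "clinear A" "clinear B" "clinear C"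
  shows "clinear (upper_tri A C B)"
  by (rule clinearI)
    (auto simp: upper_tri_def scaleC_prod_def scaleC_add_right
      module_hom.add[OF assms(1)] module_hom.add[OF assms(2)] module_hom.add[OF assms(3)]
      module_hom.scale[OF assms(1)] module_hom.scale[OF assms(2)] module_hom.scale[OF assms(3)])

lemma shift_upper_tri: "shift (upper_tri A C B) z = upper_tri (shift A z) C (shift B z)"
  by (auto simp: shift_def upper_tri_def scaleC_prod_def fun_eq_iff)

lemma clinear_fst: "clinear fst"
  and clinear_snd: "clinear snd"
  and clinear_Pair_0: "clinear (\<lambda>x. (x, 0))"
  and clinear_0_Pair: "clinear (\<lambda>y. (0, y))"
  by (rule clinearI; simp add: scaleC_prod_def)+

lemma finite_codim_upper_tri:
  fixes A :: "'x::complex_normed_vector \<Rightarrow> 'x" and B :: "'y::complex_normed_vector \<Rightarrow> 'y"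
  assumes A: "clinear A" and B: "clinear B" and C: "clinear C"
    and finA: "finite_modulo (range A) UNIV" and finB: "finite_modulo (range B) UNIV"
  shows "finite_modulo (range (upper_tri A C B)) UNIV"
proof -
  define M where "M = upper_tri A C B"
  define i j where "i x = (x, 0 :: 'y)" and "j y = (0 :: 'x, y)" for x :: 'x and y :: 'y
  have "i (A u) = M (u, 0)" for u
    by (simp add: M_def upper_tri_def i_def module_hom.zero[OF B] module_hom.zero[OF C])
  then have "i ` range A \<subseteq> range M"
    by auto
  moreover have "finite_modulo (i ` range A) (range i)"
    unfolding i_def using finite_modulo_image[OF clinear_Pair_0 finA] by simp
  ultimately have i: "finite_modulo (range M) (range i)"
    using finite_modulo_mono by blast
  have "(0, B v) = M (0, v) - i (C v)" for v
    by (simp add: M_def upper_tri_def i_def module_hom.zero[OF A])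
  moreover have "M (0, v) - i (C v) \<in> cspan (range M \<union> range i)" for v
    by (intro complex_vector.span_diff complex_vector.span_base) auto
  ultimately have "j ` range B \<subseteq> cspan (range M \<union> range i)"
    by (auto simp: j_def)
  then have "finite_modulo (range M) (j ` range B)"
    by (rule finite_modulo_cspan_Un[OF finite_modulo_refl i])
  moreover have "finite_modulo (j ` range B) (range j)"
    unfolding j_def using finite_modulo_image[OF clinear_0_Pair finB] by simp
  ultimately have j: "finite_modulo (range M) (range j)"
    by (rule finite_modulo_trans)
  have "i x + j y \<in> cspan (range i \<union> range j)" for x y
    by (intro complex_vector.span_add complex_vector.span_base) auto
  then have "UNIV \<subseteq> cspan (range i \<union> range j)"
    by (auto simp: i_def j_def)
  with i j show ?thesis
    unfolding M_def by (rule finite_modulo_cspan_Un)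
qed

lemma finite_codim_lower_corner:
  assumes "finite_modulo (range (upper_tri A C B)) UNIV"
  shows "finite_modulo (range B) UNIV"
proof -
  have "finite_modulo (snd ` range (upper_tri A C B)) (range snd)"
    using finite_modulo_image[OF clinear_snd assms] by simp
  then show ?thesis
    by (rule finite_modulo_mono) (auto simp: upper_tri_def)
qed

text \<open>Intersecting \<open>R(M)\<close> with \<open>X \<times> {0}\<close> gives \<open>R(A) + C(N(B))\<close>, which has finite codimension in \<open>X\<close>
  and exceeds \<open>R(A)\<close> by the finite-dimensional \<open>C(N(B))\<close>.\<close>

lemma finite_codim_upper_corner:
  assumes A: "clinear A" and B: "clinear B" and C: "clinear C"
    and fin: "finite_modulo (range (upper_tri A C B)) UNIV"
    and ker: "finite_modulo {} (kernel B)"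
  shows "finite_modulo (range A) UNIV"
proof -
  define M where "M = upper_tri A C B"
  define V where "V = {x. (x, 0) \<in> range M}"
  have "clinear M"
    unfolding M_def by (rule clinear_upper_tri[OF A B C])
  have "finite_modulo (range M) (range (\<lambda>x. (x, 0)))"
    using fin unfolding M_def by (rule finite_modulo_mono) auto
  from finite_modulo_vimage[OF clinear_Pair_0 _ csubspace_range[OF \<open>clinear M\<close>] this]
  have "finite_modulo V UNIV"
    by (simp add: V_def)
  moreover have "finite_modulo (range A) V"
  proof (rule finite_modulo_cspan_Un[OF finite_modulo_refl])
    show "finite_modulo (range A) (C ` kernel B)"
      using finite_modulo_image[OF C ker] by (rule finite_modulo_mono) auto
    show "V \<subseteq> cspan (range A \<union> C ` kernel B)"
    proof
      fix x assume "x \<in> V"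
      then obtain u v where "x = A u + C v" "B v = 0"
        by (auto simp: V_def M_def upper_tri_def)
      moreover have "A u \<in> cspan (range A \<union> C ` kernel B)"
        by (rule complex_vector.span_base) simp
      moreover have "C v \<in> cspan (range A \<union> C ` kernel B)"
        by (rule complex_vector.span_base) (use \<open>B v = 0\<close> in \<open>simp add: kernel_def\<close>)
      ultimately show "x \<in> cspan (range A \<union> C ` kernel B)"
        by (simp add: complex_vector.span_add)
    qed
  qed
  ultimately show ?thesis
    using finite_modulo_trans by blast
qed

text \<open>The formula is the inverse of a triangular matrix, with entries \<open>A'\<close>, \<open>- A' C B'\<close>, \<open>B'\<close>.\<close>

lemma right_inverse_modulo_upper_tri:
  assumes C: "bounded_clinear C"
    and A': "right_inverse_modulo F A A'" and B': "right_inverse_modulo G B B'"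
  shows "right_inverse_modulo ((\<lambda>x. (x, 0)) ` F \<union> (\<lambda>y. (0, y)) ` G) (upper_tri A C B)
    (\<lambda>(x, y). (A' (x - C (B' y)), B' y))"
proof -
  have bA': "bounded_clinear A'" and A'_eq: "\<And>x. x - A (A' x) \<in> cspan F"
    and bB': "bounded_clinear B'" and B'_eq: "\<And>y. y - B (B' y) \<in> cspan G"
    using A' B' by (auto simp: right_inverse_modulo_def)
  have B'_snd: "bounded_linear (\<lambda>p. B' (snd p))"
    using bB' by (intro bounded_linear_compose[OF _ bounded_linear_snd]) (simp add: bounded_clinear_def)
  have "bounded_linear (\<lambda>p. C (B' (snd p)))"
    using C by (intro bounded_linear_compose[OF _ B'_snd]) (simp add: bounded_clinear_def)
  then have "bounded_linear (\<lambda>p. A' (fst p - C (B' (snd p))))"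
    using bA' by (intro bounded_linear_compose[OF _ bounded_linear_sub[OF bounded_linear_fst]])
      (simp_all add: bounded_clinear_def)
  then have "bounded_linear (\<lambda>p. (A' (fst p - C (B' (snd p))), B' (snd p)))"
    by (rule bounded_linear_Pair[OF _ B'_snd])
  then have bdd: "bounded_clinear (\<lambda>(x, y). (A' (x - C (B' y)), B' y))"
    using bA' bB' C
    by (simp add: bounded_clinear_def scaleC_prod_def case_prod_unfold
        flip: complex_vector.scale_right_diff_distrib)
  have "(x, y) - upper_tri A C B (A' (x - C (B' y)), B' y)
      \<in> cspan ((\<lambda>x. (x, 0)) ` F \<union> (\<lambda>y. (0, y)) ` G)" for x y
  proof -
    define u where "u = x - C (B' y)"
    have "(u - A (A' u), 0) \<in> cspan ((\<lambda>x. (x, 0)) ` F)"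
      unfolding clinear_image_cspan[OF clinear_Pair_0, symmetric] using A'_eq by blast
    moreover have "(0, y - B (B' y)) \<in> cspan ((\<lambda>y. (0, y)) ` G)"
      unfolding clinear_image_cspan[OF clinear_0_Pair, symmetric] using B'_eq by blast
    ultimately have "(u - A (A' u), 0) + (0, y - B (B' y))
        \<in> cspan ((\<lambda>x. (x, 0)) ` F \<union> (\<lambda>y. (0, y)) ` G)"
      unfolding complex_vector.span_Un by blast
    moreover have "(u - A (A' u), 0) + (0, y - B (B' y))
        = (x, y) - upper_tri A C B (A' (x - C (B' y)), B' y)"
      by (simp add: u_def upper_tri_def)
    ultimately show ?thesis by simp
  qed
  with bdd show ?thesis
    by (auto simp: right_inverse_modulo_def)
qed

lemma right_inverse_modulo_lower_corner:
  assumes "right_inverse_modulo F (upper_tri A C B) S"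
  shows "right_inverse_modulo (snd ` F) B (\<lambda>y. snd (S (0, y)))"
proof -
  have S: "bounded_linear S" "\<And>c p. S (c *\<^sub>C p) = c *\<^sub>C S p"
      "\<And>p. p - upper_tri A C B (S p) \<in> cspan F"
    using assms by (auto simp: right_inverse_modulo_def bounded_clinear_def)
  have "bounded_linear (\<lambda>y. snd (S (0, y)))"
    by (intro bounded_linear_compose[OF bounded_linear_snd] bounded_linear_compose[OF S(1)]
        bounded_linear_Pair bounded_linear_zero bounded_linear_ident)
  moreover have "snd (S (0, c *\<^sub>C y)) = c *\<^sub>C snd (S (0, y))" for c y
    using S(2)[of c "(0, y)"] by (simp add: scaleC_prod_def)
  moreover have "y - B (snd (S (0, y))) \<in> cspan (snd ` F)" for y
    using imageI[OF S(3)[of "(0, y)"], of snd] unfolding clinear_image_cspan[OF clinear_snd]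
    by (simp add: upper_tri_def case_prod_unfold)
  ultimately show ?thesis
    by (simp add: right_inverse_modulo_def bounded_clinear_def)
qed

text \<open>In a right inverse of the matrix, the lower left entry \<open>x \<mapsto> snd (S (x, 0))\<close> takes values in the
  preimage under \<open>B\<close> of the error space. If that preimage is small, the upper left entry is a right
  inverse of \<open>A\<close> up to the image of this preimage under \<open>C\<close>.\<close>

lemma right_inverse_modulo_upper_corner:
  assumes B: "clinear B" and C: "clinear C" and S: "right_inverse_modulo F (upper_tri A C B) S"
    and G: "{y. B y \<in> cspan (snd ` F)} \<subseteq> cspan G"
  shows "right_inverse_modulo (fst ` F \<union> C ` G) A (\<lambda>x. fst (S (x, 0)))"
proof -
  have S: "bounded_linear S" "\<And>c p. S (c *\<^sub>C p) = c *\<^sub>C S p"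
      "\<And>p. p - upper_tri A C B (S p) \<in> cspan F"
    using S by (auto simp: right_inverse_modulo_def bounded_clinear_def)
  have "bounded_linear (\<lambda>x. fst (S (x, 0)))"
    by (intro bounded_linear_compose[OF bounded_linear_fst] bounded_linear_compose[OF S(1)]
        bounded_linear_Pair bounded_linear_zero bounded_linear_ident)
  moreover have "fst (S (c *\<^sub>C x, 0)) = c *\<^sub>C fst (S (x, 0))" for c x
    using S(2)[of c "(x, 0)"] by (simp add: scaleC_prod_def)
  moreover have "x - A (fst (S (x, 0))) \<in> cspan (fst ` F \<union> C ` G)" for x
  proof -
    define u v where "u = fst (S (x, 0))" and "v = snd (S (x, 0))"
    have uv: "(x - (A u + C v), - B v) \<in> cspan F"
      using S(3)[of "(x, 0)"] by (simp add: upper_tri_def u_def v_def case_prod_unfold)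
    have "- B v \<in> cspan (snd ` F)"
      using imageI[OF uv, of snd] unfolding clinear_image_cspan[OF clinear_snd] by simp
    then have "v \<in> cspan G"
      using G complex_vector.span_neg by fastforce
    then have "C v \<in> cspan (C ` G)"
      unfolding clinear_image_cspan[OF C, symmetric] by blast
    moreover have "x - (A u + C v) \<in> cspan (fst ` F)"
      using imageI[OF uv, of fst] unfolding clinear_image_cspan[OF clinear_fst] by simp
    ultimately have "(x - (A u + C v)) + C v \<in> cspan (fst ` F \<union> C ` G)"
      unfolding complex_vector.span_Un by blast
    then show ?thesis
      by (simp add: u_def)
  qed
  ultimately show ?thesis
    by (simp add: right_inverse_modulo_def bounded_clinear_def)
qed

lemma finite_preimage_of_finite:
  assumes B: "clinear B" and ker: "finite_modulo {} (kernel B)" and F: "finite F"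
  shows "\<exists>G. finite G \<and> {y. B y \<in> cspan F} \<subseteq> cspan G"
proof -
  define D where "D = B -` cspan F"
  have "csubspace D"
    unfolding D_def by (rule csubspace_vimage[OF B]) simp
  moreover have "finite_modulo {0} (B ` D)"
    unfolding finite_modulo_def using F
    by (intro exI[of _ F]) (auto simp: D_def intro: subsetD[OF complex_vector.span_mono[of F]])
  ultimately have "finite_modulo {y \<in> D. B y \<in> {0}} D"
    by (intro finite_modulo_vimage[OF B] complex_vector.subspace_single_0)
  then have "finite_modulo (kernel B) D"
    by (rule finite_modulo_mono) (auto simp: kernel_def)
  with ker have "finite_modulo {} D"
    by (rule finite_modulo_trans)
  then show ?thesis
    by (auto simp: finite_modulo_def D_def)
qed

lemma range_funpow_stable:
  fixes T :: "'a \<Rightarrow> 'a"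
  assumes "range (T ^^ k) = range (T ^^ Suc k)" "k \<le> n"
  shows "range (T ^^ n) = range (T ^^ k)"
  using assms(2)
proof (induction n rule: dec_induct)
  case (step n)
  have "range (T ^^ Suc n) = T ` range (T ^^ n)"
    by (simp add: image_comp)
  also have "\<dots> = range (T ^^ Suc k)"
    using step by (simp add: image_comp)
  finally show ?case
    using assms(1) by simp
qed simp

lemma upper_tri_funpow_Pair_0:
  assumes "clinear B" "clinear C"
  shows "(upper_tri A C B ^^ n) (x, 0) = ((A ^^ n) x, 0)"
  using module_hom.zero[OF assms(1)] module_hom.zero[OF assms(2)]
  by (induction n) (auto simp: upper_tri_def)

lemma snd_upper_tri_funpow: "snd ((upper_tri A C B ^^ n) p) = (B ^^ n) (snd p)"
  by (induction n) (auto simp: upper_tri_def case_prod_unfold)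

text \<open>After \<open>q\<close> steps the second component can be cleared by subtracting an element of \<open>R(M\<^sup>q\<^sup>+\<^sup>1)\<close>;
  what is left evolves under \<open>A\<close> alone, and \<open>p\<close> further steps put it into \<open>R(A\<^sup>n)\<close> for every \<open>n \<ge> p\<close>.\<close>

lemma finite_descent_upper_tri:
  fixes A :: "'x::complex_normed_vector \<Rightarrow> 'x" and B :: "'y::complex_normed_vector \<Rightarrow> 'y"
  assumes A: "clinear A" and B: "clinear B" and C: "clinear C"
    and p: "range (A ^^ p) = range (A ^^ Suc p)" and q: "range (B ^^ q) = range (B ^^ Suc q)"
  shows "range (upper_tri A C B ^^ (p + q)) = range (upper_tri A C B ^^ Suc (p + q))"
proof
  define M where "M = upper_tri A C B"
  have M: "clinear M"
    unfolding M_def by (rule clinear_upper_tri[OF A B C])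
  note Mn = clinear_funpow[OF M]
  show "range (upper_tri A C B ^^ (p + q)) \<subseteq> range (upper_tri A C B ^^ Suc (p + q))"
  proof (rule image_subsetI)
    fix xy :: "'x \<times> 'y"
    obtain x y where xy: "xy = (x, y)"
      by (cases xy)
    have "(B ^^ q) y \<in> range (B ^^ Suc q)"
      using q by blast
    then obtain y' where y': "(B ^^ q) y = (B ^^ Suc q) y'" by blast
    define d where "d = (M ^^ q) (x, y) - (M ^^ Suc q) (0, y')"
    have "snd d = (B ^^ q) y - (B ^^ Suc q) y'"
      unfolding d_def M_def snd_diff snd_upper_tri_funpow by simp
    then obtain x'' where d: "d = (x'', 0)"
      using y' by (cases d) simp
    have "(A ^^ p) x'' \<in> range (A ^^ Suc (p + q))"
      using range_funpow_stable[OF p, of "Suc (p + q)"] by auto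
    then obtain u where u: "(A ^^ p) x'' = (A ^^ Suc (p + q)) u" by blast
    have "(M ^^ p) d = (M ^^ Suc (p + q)) (u, 0)"
      unfolding d M_def upper_tri_funpow_Pair_0[OF B C] u ..
    moreover have "(M ^^ p) d = (M ^^ (p + q)) (x, y) - (M ^^ (p + Suc q)) (0, y')"
      unfolding d_def module_hom.diff[OF Mn] funpow_add o_apply ..
    ultimately have "(M ^^ (p + q)) (x, y) = (M ^^ Suc (p + q)) (u, 0) + (M ^^ Suc (p + q)) (0, y')"
      by (simp only: add_Suc_right) (simp add: algebra_simps)
    also have "\<dots> = (M ^^ Suc (p + q)) (u, y')"
      by (simp only: module_hom.add[OF Mn, symmetric] add_Pair add_0 add_0_right)
    finally show "(upper_tri A C B ^^ (p + q)) xy \<in> range (upper_tri A C B ^^ Suc (p + q))"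
      unfolding M_def xy by blast
  qed
  show "range (upper_tri A C B ^^ Suc (p + q)) \<subseteq> range (upper_tri A C B ^^ (p + q))"
    unfolding funpow_Suc_right by auto
qed

lemma finite_descent_lower_corner:
  fixes A :: "'x::complex_normed_vector \<Rightarrow> 'x" and B :: "'y::complex_normed_vector \<Rightarrow> 'y"
  assumes "range (upper_tri A C B ^^ k) = range (upper_tri A C B ^^ Suc k)"
  shows "range (B ^^ k) = range (B ^^ Suc k)"
proof -
  have "snd ` range (upper_tri A C B ^^ n) = range (B ^^ n)" for n
  proof -
    have "snd ` range (upper_tri A C B ^^ n) = (B ^^ n) ` range (snd :: 'x \<times> 'y \<Rightarrow> 'y)"
      by (simp only: image_image snd_upper_tri_funpow)
    then show ?thesis by simp
  qed
  with assms show ?thesis by metis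
qed

text \<open>If \<open>(A\<^sup>k x, 0) = M\<^sup>k\<^sup>+\<^sup>1\<^sup>+\<^sup>q (u, v)\<close>, then \<open>v\<close> is annihilated by a power of \<open>B\<close>, hence already by
  \<open>B\<^sup>q\<close>. So \<open>M\<^sup>q (u, v)\<close> has the form \<open>(w, 0)\<close>, and \<open>A\<^sup>k x = A\<^sup>k\<^sup>+\<^sup>1 w\<close>.\<close>

lemma finite_descent_upper_corner:
  assumes B: "clinear B" and C: "clinear C"
    and k: "range (upper_tri A C B ^^ k) = range (upper_tri A C B ^^ Suc k)"
    and q: "kernel B \<inter> range (B ^^ q) = {0}"
  shows "range (A ^^ k) = range (A ^^ Suc k)"
proof
  define M where "M = upper_tri A C B"
  have ascent: "(B ^^ q) v = 0" if "(B ^^ (m + q)) v = 0" for m v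
    using that
  proof (induction m)
    case (Suc m)
    then have "(B ^^ (m + q)) v \<in> kernel B"
      by (simp add: kernel_def)
    moreover have "(B ^^ (m + q)) v = (B ^^ q) ((B ^^ m) v)"
      by (metis add.commute comp_apply funpow_add)
    ultimately have "(B ^^ (m + q)) v \<in> kernel B \<inter> range (B ^^ q)"
      by simp
    then show ?case
      using q Suc.IH by simp
  qed simp
  show "range (A ^^ k) \<subseteq> range (A ^^ Suc k)"
  proof clarify
    fix x
    have "(M ^^ k) (x, 0) \<in> range (M ^^ (Suc k + q))"
      using range_funpow_stable[OF k, of "Suc k + q"] by (simp add: M_def)
    then obtain p where p: "(M ^^ k) (x, 0) = (M ^^ (Suc k + q)) p" by blast
    have "snd ((M ^^ (Suc k + q)) p) = 0"
      unfolding p[symmetric] unfolding M_def upper_tri_funpow_Pair_0[OF B C] by simp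
    then have "(B ^^ q) (snd p) = 0"
      unfolding M_def snd_upper_tri_funpow by (rule ascent)
    then have "snd ((M ^^ q) p) = 0"
      unfolding M_def snd_upper_tri_funpow .
    then obtain w where w: "(M ^^ q) p = (w, 0)"
      by (cases "(M ^^ q) p") simp
    have "((A ^^ k) x, 0) = (M ^^ Suc k) ((M ^^ q) p)"
      using p unfolding M_def upper_tri_funpow_Pair_0[OF B C] funpow_add o_apply .
    also have "\<dots> = ((A ^^ Suc k) w, 0)"
      unfolding w unfolding M_def upper_tri_funpow_Pair_0[OF B C] ..
    finally show "(A ^^ k) x \<in> range (A ^^ Suc k)"
      by blast
  qed
  show "range (A ^^ Suc k) \<subseteq> range (A ^^ k)"
    unfolding funpow_Suc_right by auto
qed

section \<open>The spectra of an upper triangular operator matrix\<close>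

context
  fixes A :: "'x::complex_banach \<Rightarrow> 'x" and B :: "'y::complex_banach \<Rightarrow> 'y" and C :: "'y \<Rightarrow> 'x"
    and z :: complex
  assumes A: "bounded_clinear A" and B: "bounded_clinear B" and C: "bounded_clinear C"
    and svep: "SVEP_at B z"
begin

lemma descent_upper_tri_iff:
  "descent (shift (upper_tri A C B) z) < \<infinity> \<longleftrightarrow>
    descent (shift A z) < \<infinity> \<and> descent (shift B z) < \<infinity>"
proof -
  have lin: "clinear (shift A z)" "clinear (shift B z)" "clinear C"
    by (intro bounded_clinear_imp_clinear bounded_clinear_shift A B C)+
  show ?thesis
    unfolding descent_finite_iff shift_upper_tri
  proof (intro iffI conjI; elim exE conjE)
    fix k assume k: "range (upper_tri (shift A z) C (shift B z) ^^ k) =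
        range (upper_tri (shift A z) C (shift B z) ^^ Suc k)"
    then have Bk: "range (shift B z ^^ k) = range (shift B z ^^ Suc k)"
      by (rule finite_descent_lower_corner)
    then show "\<exists>k. range (shift B z ^^ k) = range (shift B z ^^ Suc k)" ..
    show "\<exists>k. range (shift A z ^^ k) = range (shift A z ^^ Suc k)"
      using finite_descent_upper_corner[OF lin(2,3) k
          SVEP_kernel_Int_range_finite_descent[OF B svep Bk]] ..
  next
    fix p q assume "range (shift A z ^^ p) = range (shift A z ^^ Suc p)"
      "range (shift B z ^^ q) = range (shift B z ^^ Suc q)"
    from finite_descent_upper_tri[OF lin this]
    show "\<exists>k. range (upper_tri (shift A z) C (shift B z) ^^ k) =
        range (upper_tri (shift A z) C (shift B z) ^^ Suc k)" ..
  qed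
qed

lemma Phi_minus_upper_tri_iff:
  "shift (upper_tri A C B) z \<in> Phi_minus \<longleftrightarrow>
    shift A z \<in> Phi_minus \<and> shift B z \<in> Phi_minus"
proof -
  have bdd: "bounded_clinear (shift A z)" "bounded_clinear (shift B z)"
    "bounded_clinear (upper_tri (shift A z) C (shift B z))"
    by (intro bounded_clinear_upper_tri bounded_clinear_shift A B C)+
  note lin = bdd[THEN bounded_clinear_imp_clinear]
  note linC = bounded_clinear_imp_clinear[OF C]
  show ?thesis
    unfolding Phi_minus_def shift_upper_tri
    using bdd lin finite_codim_upper_tri[OF lin(1,2) linC]
      finite_codim_lower_corner[of "shift A z" C "shift B z"]
      finite_codim_upper_corner[OF lin(1,2) linC]
      SVEP_finite_codim_finite_kernel[OF B svep]
    by (auto simp: defect_finite_iff simp del: enat_ord_simps)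
qed

lemma Phi_r_upper_tri_iff:
  "shift (upper_tri A C B) z \<in> Phi_r \<longleftrightarrow> shift A z \<in> Phi_r \<and> shift B z \<in> Phi_r"
proof -
  have bdd: "bounded_clinear (shift A z)" "bounded_clinear (shift B z)"
    "bounded_clinear (upper_tri (shift A z) C (shift B z))"
    by (intro bounded_clinear_upper_tri bounded_clinear_shift A B C)+
  note lin = bdd[THEN bounded_clinear_imp_clinear]
  note linC = bounded_clinear_imp_clinear[OF C]
  show ?thesis
    unfolding shift_upper_tri Phi_r_iff[OF bdd(1)] Phi_r_iff[OF bdd(2)] Phi_r_iff[OF bdd(3)]
  proof (intro iffI; elim exE conjE)
    fix F S assume F: "finite F" and S: "right_inverse_modulo F (upper_tri (shift A z) C (shift B z)) S"
    note B' = right_inverse_modulo_lower_corner[OF S]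
    have "finite_modulo (range (shift B z)) UNIV"
      by (rule right_inverse_modulo_range[OF lin(2) B' finite_imageI[OF F]])
    then have "finite_modulo {} (kernel (shift B z))"
      by (rule SVEP_finite_codim_finite_kernel[OF B svep])
    from finite_preimage_of_finite[OF lin(2) this finite_imageI[OF F]]
    obtain G where G: "finite G" "{y. (shift B z) y \<in> cspan (snd ` F)} \<subseteq> cspan G"
      by blast
    note A' = right_inverse_modulo_upper_corner[OF lin(2) linC S G(2)]
    show "(\<exists>F S. finite F \<and> right_inverse_modulo F (shift A z) S) \<and>
        (\<exists>F S. finite F \<and> right_inverse_modulo F (shift B z) S)"
    proof (intro conjI exI)
      show "finite (fst ` F \<union> C ` G)" "finite (snd ` F)"
        using F G by auto
    qed (rule A' B')+
  next
    fix F G A' B' assume *: "finite F" "right_inverse_modulo F (shift A z) A'"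
      "finite G" "right_inverse_modulo G (shift B z) B'"
    show "\<exists>F S. finite F \<and> right_inverse_modulo F (upper_tri (shift A z) C (shift B z)) S"
    proof (intro exI conjI)
      show "finite ((\<lambda>x. (x, 0)) ` F \<union> (\<lambda>y. (0, y)) ` G)"
        using * by auto
    qed (rule right_inverse_modulo_upper_tri[OF C *(2,4)])
  qed
qed

lemma right_invertible_upper_tri_iff:
  "right_invertible (shift (upper_tri A C B) z) \<longleftrightarrow> right_invertible (shift A z) \<and> right_invertible (shift B z)"
proof -
  have bdd: "bounded_clinear (shift A z)" "bounded_clinear (shift B z)"
    by (intro bounded_clinear_shift A B)+
  note lin = bdd[THEN bounded_clinear_imp_clinear]
  note linC = bounded_clinear_imp_clinear[OF C]
  show ?thesis
    unfolding shift_upper_tri right_invertible_iff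
  proof (intro iffI; elim exE conjE)
    fix S assume S: "right_inverse_modulo {} (upper_tri (shift A z) C (shift B z)) S"
    from right_inverse_modulo_lower_corner[OF S]
    have B': "right_inverse_modulo {} (shift B z) (\<lambda>y. snd (S (0, y)))"
      by simp
    have "range (shift B z) = UNIV"
      using B' unfolding right_inverse_modulo_def by (simp add: surj_def) metis
    then have "kernel (shift B z) = {0}"
      using SVEP_kernel_Int_range_finite_descent[OF B svep, of 0] by simp
    then have "{y. (shift B z) y \<in> cspan (snd ` {})} \<subseteq> cspan {}"
      by (simp add: kernel_def)
    from right_inverse_modulo_upper_corner[OF lin(2) linC S this]
    have "right_inverse_modulo {} (shift A z) (\<lambda>x. fst (S (x, 0)))"
      by simp
    with B' show "(\<exists>S. right_inverse_modulo {} (shift A z) S) \<and>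
        (\<exists>S. right_inverse_modulo {} (shift B z) S)"
      by blast
  next
    fix A' B' assume "right_inverse_modulo {} (shift A z) A'" "right_inverse_modulo {} (shift B z) B'"
    from right_inverse_modulo_upper_tri[OF C this]
    show "\<exists>S. right_inverse_modulo {} (upper_tri (shift A z) C (shift B z)) S"
      by auto
  qed
qed

end

theorem theorem3p3:
  fixes A :: "'x::complex_banach \<Rightarrow> 'x"
    and B :: "'y::complex_banach \<Rightarrow> 'y"
    and C :: "'y \<Rightarrow> 'x"
  assumes "infinite_dimensional TYPE('x)" and "infinite_dimensional TYPE('y)"
    and "bounded_clinear A" and "bounded_clinear B" and "bounded_clinear C"
  defines "M \<equiv> upper_tri A C B"
  shows "sigma_des M \<union> S_set B = sigma_des A \<union> sigma_des B \<union> S_set B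
    \<and> sigma_r M \<union> S_set B = sigma_r A \<union> sigma_r B \<union> S_set B
    \<and> sigma_rb M \<union> S_set B = sigma_rb A \<union> sigma_rb B \<union> S_set B
    \<and> sigma_sb M \<union> S_set B = sigma_sb A \<union> sigma_sb B \<union> S_set B
    \<and> sigma_re M \<union> S_set B = sigma_re A \<union> sigma_re B \<union> S_set B
    \<and> sigma_SF_minus M \<union> S_set B = sigma_SF_minus A \<union> sigma_SF_minus B \<union> S_set B"
proof -
  note iffs = descent_upper_tri_iff[OF assms(3-5)] right_invertible_upper_tri_iff[OF assms(3-5)]
    Phi_minus_upper_tri_iff[OF assms(3-5)] Phi_r_upper_tri_iff[OF assms(3-5)]
  have union_cong: "P \<union> S_set B = Q \<union> R \<union> S_set B"
    if "\<And>z. SVEP_at B z \<Longrightarrow> z \<in> P \<longleftrightarrow> z \<in> Q \<or> z \<in> R" for P Q R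
    using that by (auto simp: S_set_def)
  show ?thesis
    unfolding M_def
    by (intro conjI union_cong; simp only: iffs descent_infinite_iff sigma_des_def sigma_r_def
        sigma_rb_def sigma_sb_def sigma_re_def sigma_SF_minus_def Phi_rb_def Phi_sb_def mem_Collect_eq;
        blast)
qed

end
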